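(* Let $n\ge 1$, let $M(s)\in\mathscr{C}$ and $N(s)\in\mathscr{C}_s$ be $n\times n$ transfer function matrices, and suppose in addition that $M(\infty)N(\infty)=0$ and $N(\infty)\ge 0$. Then $$[M(s),N(s)]\ \text{is internally stable}\quad\Longleftrightarrow\quad \overline{\lambda}(M(0)N(0))<1.$$
   Context: $\mathscr{RH}_\infty^{n\times n}$ denotes the set of $n\times n$ real-rational, proper, stable transfer function matrices (all poles in the open left half plane). $X^*$ denotes the complex conjugate transpose of $X$. For matrices, $X>0$ (resp. $X\ge 0$) means $X$ is Hermitian (symmetric in the real case) and positive definite (resp. positive semidefinite). $R(\infty)$ denotes $\lim_{s\to\infty}R(s)$. With $j$ the imaginary unit, define $$\mathscr{C}:=\{R(s)\in\mathscr{RH}_\infty^{n\times n}:\ j[R(j\omega)-R(j\omega)^*]\ge 0\ \text{ for all }\omega\in(0,\infty)\},$$ $$\mathscr{C}_s:=\{R(s)\in\mathscr{RH}_\infty^{n\times n}:\ j[R(j\omega)-R(j\omega)^*]> 0\ \text{ for all }\omega\in(0,\infty)\}.$$ $\overline{\lambda}(A)$ denotes the maximum eigenvalue of a square complex matrix $A$ that has only real eigenvalues (under the hypotheses of the claim, $M(0)N(0)$ has only real eigenvalues). $[M(s),N(s)]$ denotes the positive feedback interconnection of $M(s)$ and $N(s)$: with external inputs $w_1,w_2$, the input of $M$ is $e_1=w_1+Ne_2$ and the input of $N$ is $e_2=w_2+Me_1$. Internal stability has its standard meaning: the loop is well-posed ($I-M(\infty)N(\infty)$ is invertible) and all the transfer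 function matrices from $(w_1,w_2)$ to $(e_1,e_2)$ are in $\mathscr{RH}_\infty$. *)

theory Defs
  imports
    "HOL-Analysis.Analysis"
    "HOL-Computational_Algebra.Computational_Algebra"
    "HOL-Computational_Algebra.Field_as_Ring"
begin

type_synonym 'n tfm = "real poly fract ^ 'n ^ 'n"

definition num_of :: "real poly fract \<Rightarrow> real poly" where
  "num_of r = fst (quot_of_fract r)"

(* quot_of_fract yields coprime numerator and denominator, so the complex roots of the
   denominator are exactly the poles. *)
definition den_of :: "real poly fract \<Rightarrow> real poly" where
  "den_of r = snd (quot_of_fract r)"

definition rat_proper :: "real poly fract \<Rightarrow> bool" where
  "rat_proper r \<longleftrightarrow> degree (num_of r) \<le> degree (den_of r)"

definition rat_stable :: "real poly fract \<Rightarrow> bool" where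
  "rat_stable r \<longleftrightarrow> (\<forall>s. poly (map_poly complex_of_real (den_of r)) s = 0 \<longrightarrow> Re s < 0)"

definition RH_inf :: "('n::finite) tfm set" where
  "RH_inf = {R. \<forall>i j. rat_proper (R $ i $ j) \<and> rat_stable (R $ i $ j)}"

(* At a pole the value is 0 by the convention for division; for members of RH_inf this never
   happens in the closed right half plane. *)
definition rat_eval :: "real poly fract \<Rightarrow> complex \<Rightarrow> complex" where
  "rat_eval r s =
     poly (map_poly complex_of_real (num_of r)) s / poly (map_poly complex_of_real (den_of r)) s"

definition tf_eval :: "('n::finite) tfm \<Rightarrow> complex \<Rightarrow> complex ^ 'n ^ 'n" where
  "tf_eval R s = map_matrix (\<lambda>r. rat_eval r s) R"

definition tf_at_inf :: "('n::finite) tfm \<Rightarrow> complex ^ 'n ^ 'n" where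
  "tf_at_inf R = Lim at_infinity (tf_eval R)"

definition ctranspose :: "complex ^ 'n ^ 'm \<Rightarrow> complex ^ 'm ^ 'n" where
  "ctranspose A = transpose (map_matrix cnj A)"

(* The quadratic form of a Hermitian matrix is real valued, so taking Re loses nothing in the
   next two definitions. *)
definition pos_semidef :: "complex ^ 'n ^ 'n \<Rightarrow> bool" where
  "pos_semidef A \<longleftrightarrow> ctranspose A = A \<and> (\<forall>x. 0 \<le> Re (\<Sum>i\<in>UNIV. cnj (x $ i) * (A *v x) $ i))"

definition pos_def :: "complex ^ 'n ^ 'n \<Rightarrow> bool" where
  "pos_def A \<longleftrightarrow>
     ctranspose A = A \<and> (\<forall>x. x \<noteq> 0 \<longrightarrow> 0 < Re (\<Sum>i\<in>UNIV. cnj (x $ i) * (A *v x) $ i))"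

definition NI_form :: "('n::finite) tfm \<Rightarrow> real \<Rightarrow> complex ^ 'n ^ 'n" where
  "NI_form R \<omega> =
     (let A = tf_eval R (\<i> * complex_of_real \<omega>) in map_matrix (\<lambda>z. \<i> * z) (A - ctranspose A))"

definition NI_class :: "('n::finite) tfm set" where
  "NI_class = {R \<in> RH_inf. \<forall>\<omega>>0. pos_semidef (NI_form R \<omega>)}"

definition strict_NI_class :: "('n::finite) tfm set" where
  "strict_NI_class = {R \<in> RH_inf. \<forall>\<omega>>0. pos_def (NI_form R \<omega>)}"

definition eigenvalue_of :: "complex ^ 'n ^ 'n \<Rightarrow> complex \<Rightarrow> bool" where
  "eigenvalue_of A l \<longleftrightarrow> (\<exists>v. v \<noteq> 0 \<and> A *v v = l *s v)"

(* Only meant for matrices all of whose eigenvalues are real. *)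
definition max_eigenvalue :: "complex ^ 'n ^ 'n \<Rightarrow> real" where
  "max_eigenvalue A = Max {x. eigenvalue_of A (complex_of_real x)}"

(* H11, H12, H21, H22 are the transfer function matrices from (w1, w2) to (e1, e2) in the
   positive feedback loop e1 = w1 + N e2, e2 = w2 + M e1. Signals range over vectors of rational
   functions; these include the constant unit vectors, so the four matrices are unique if they
   exist, and they exist iff the loop equations are uniquely solvable over the rational
   functions. *)
definition closed_loop_maps ::
  "('n::finite) tfm \<Rightarrow> 'n tfm \<Rightarrow> 'n tfm \<Rightarrow> 'n tfm \<Rightarrow> 'n tfm \<Rightarrow> 'n tfm \<Rightarrow> bool" where
  "closed_loop_maps M N H11 H12 H21 H22 \<longleftrightarrow>
     (\<forall>w1 w2 e1 e2. (e1 = w1 + N *v e2 \<and> e2 = w2 + M *v e1) \<longleftrightarrow>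
        (e1 = H11 *v w1 + H12 *v w2 \<and> e2 = H21 *v w1 + H22 *v w2))"

definition internally_stable :: "('n::finite) tfm \<Rightarrow> 'n tfm \<Rightarrow> bool" where
  "internally_stable M N \<longleftrightarrow>
     invertible (mat 1 - tf_at_inf M ** tf_at_inf N) \<and>
     (\<exists>H11 H12 H21 H22. closed_loop_maps M N H11 H12 H21 H22 \<and>
        H11 \<in> RH_inf \<and> H12 \<in> RH_inf \<and> H21 \<in> RH_inf \<and> H22 \<in> RH_inf)"

end

theory Submission
  imports Defs "HOL-Complex_Analysis.Conformal_Mappings"
begin

text \<open>
  Write \<open>x\<^sup>H R(s) x\<close> for the quadratic form of a transfer matrix. For a negative imaginary \<open>R\<close> its
  imaginary part is nonpositive on the positive imaginary axis, nonnegative on the negative one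
  (the coefficients are real), and zero at the origin and at infinity. Therefore
  \<open>(R(0) - R(s)) / s\<close> and \<open>s (R(s) - R(\<infinity>))\<close>, which are again proper and stable, have forms with
  nonnegative real part on the imaginary axis, and by the maximum modulus principle on the whole
  right half plane (\<open>neg_imag_difference\<close>, \<open>neg_imag_inf_difference\<close>). In particular
  \<open>R(\<infinity>) \<le> R(0)\<close>, with strict inequality if \<open>R\<close> is strictly negative imaginary, so
  \<open>N(\<infinity>) \<ge> 0\<close> gives \<open>N(0) > 0\<close>. By a Rayleigh quotient argument (\<open>product_form_max\<close>) the largest
  eigenvalue of \<open>M(0) N(0)\<close> is then less than 1 iff \<open>M(0) < N(0)\<^sup>-\<^sup>1\<close>.

  If the loop is stable, its transfer matrix \<open>T = N (1 - M N)\<^sup>-\<^sup>1\<close> is itself negative imaginary with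
  \<open>T(\<infinity>) = N(\<infinity>) \<ge> 0\<close>, whence \<open>T(0) \<ge> 0\<close>. On an eigenvector of \<open>M(0) N(0)\<close> with eigenvalue \<open>\<mu>\<close> the
  form of \<open>T(0)\<close> equals that of \<open>N(0) > 0\<close> divided by \<open>1 - \<mu>\<close>, so \<open>\<mu> < 1\<close> (\<open>dc_gain_of_stable\<close>).

  Conversely, stability means that \<open>1 - N(s) M(s)\<close> is invertible at infinity, where
  \<open>M(\<infinity>) N(\<infinity>) = 0\<close> ensures it, and at each point of the closed right half plane. At the origin
  it follows from \<open>M(0) < N(0)\<^sup>-\<^sup>1\<close>, elsewhere on the imaginary axis from the strictness of \<open>N\<close>. In the open
  half plane \<open>(N(s)\<^sup>-\<^sup>1 - N(0)\<^sup>-\<^sup>1) / s\<close> and \<open>(M(0) - M(s)) / s\<close> both have nonnegative real part; a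
  vector \<open>v\<close> with \<open>N(s)\<^sup>-\<^sup>1 v = M(s) v\<close> would give \<open>v\<^sup>H (M(0) - N(0)\<^sup>-\<^sup>1) v \<ge> 0\<close>
  (\<open>loop_no_interior_zero\<close>). As \<open>N(s)\<^sup>-\<^sup>1\<close> need not be proper, it is approximated by the inverse of
  \<open>N + e\<close> for \<open>e > 0\<close> (\<open>strictly_neg_imag_inverse\<close>).
\<close>

section \<open>Proper stable rational functions\<close>

text \<open>A real polynomial, viewed as a complex one.\<close>

abbreviation cpoly :: "real poly \<Rightarrow> complex poly" where
  "cpoly \<equiv> map_poly complex_of_real"

lemma cpoly_add: "cpoly (p + q) = cpoly p + cpoly q"
  by (rule poly_eqI) (simp add: coeff_map_poly)

lemma cpoly_mult: "cpoly (p * q) = cpoly p * cpoly q"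
  by (rule poly_eqI) (simp add: coeff_map_poly coeff_mult)

lemma cpoly_smult: "cpoly (smult c p) = smult (complex_of_real c) (cpoly p)"
  by (rule poly_eqI) (simp add: coeff_map_poly)

lemma cpoly_eq_0_iff: "cpoly p = 0 \<longleftrightarrow> p = 0"
  by (simp add: map_poly_eq_0_iff)

lemma degree_cpoly: "degree (cpoly p) = degree p"
  by (simp add: degree_map_poly)

lemma poly_cpoly_cnj: "poly (cpoly p) (cnj s) = cnj (poly (cpoly p) s)"
proof -
  have "map_poly cnj (cpoly p) = cpoly p"
    by (rule poly_eqI) (simp add: coeff_map_poly)
  then show ?thesis
    by (metis poly_cnj)
qed

lemma poly_over_power_tendsto:
  fixes p :: "complex poly"
  assumes "degree p \<le> n"
  shows "((\<lambda>s. poly p s / s ^ n) \<longlongrightarrow> coeff p n) at_infinity"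
proof (cases "degree p = n")
  case True
  then show ?thesis using poly_divide_tendsto_aux[of p] by simp
next
  case False
  then have "degree p < degree (monom (1::complex) n)"
    using assms by (simp add: degree_monom_eq)
  from poly_divide_tendsto_0_at_infinity[OF this] False assms show ?thesis
    by (simp add: poly_monom coeff_eq_0)
qed

text \<open>Polynomials with all their complex zeros in the open left half plane; the zero polynomial is
  excluded, since it vanishes everywhere.\<close>

definition hurwitz :: "real poly \<Rightarrow> bool" where
  "hurwitz q \<longleftrightarrow> (\<forall>s. poly (cpoly q) s = 0 \<longrightarrow> Re s < 0)"

lemma hurwitz_nonzero: "hurwitz q \<Longrightarrow> q \<noteq> 0"
  unfolding hurwitz_def by (metis cpoly_eq_0_iff poly_0 less_irrefl zero_complex.simps(1))

lemma hurwitz_mult: "hurwitz p \<Longrightarrow> hurwitz q \<Longrightarrow> hurwitz (p * q)"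
  by (auto simp: hurwitz_def cpoly_mult)

lemma hurwitz_poly_nonzero: "hurwitz q \<Longrightarrow> Re s \<ge> 0 \<Longrightarrow> poly (cpoly q) s \<noteq> 0"
  by (auto simp: hurwitz_def)

text \<open>The scalar ring that underlies \<open>RH_inf\<close>: proper rational functions without poles in the
  closed right half plane.\<close>

definition stable_rats :: "real poly fract set" where
  "stable_rats = {r. rat_proper r \<and> rat_stable r}"

lemma RH_inf_iff: "R \<in> RH_inf \<longleftrightarrow> (\<forall>i j. R $ i $ j \<in> stable_rats)"
  by (simp add: RH_inf_def stable_rats_def)

lemma Fract_num_den: "Fract (num_of r) (den_of r) = r"
  using quot_to_fract_quot_of_fract[of r]
  by (simp add: num_of_def den_of_def quot_to_fract_def case_prod_unfold)

lemma den_nonzero: "den_of r \<noteq> 0"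
proof -
  have "quot_of_fract r \<in> normalized_fracts" by simp
  then show ?thesis
    unfolding den_of_def by (metis not_normalized_fracts_0_denom prod.collapse)
qed

lemma Fract_num_denE:
  assumes "q \<noteq> 0"
  obtains d where "p = num_of (Fract p q) * d" "q = den_of (Fract p q) * d" "d \<noteq> 0"
proof -
  have "quot_of_fract (Fract p q) = normalize_quot (p, q)"
    using quot_of_fract_quot_to_fract[of "(p, q)"] by (simp add: quot_to_fract_def)
  then show ?thesis
    using normalize_quotE[OF assms, of p] that by (metis num_of_def den_of_def)
qed

lemma rat_eval_Fract:
  assumes "poly (cpoly q) s \<noteq> 0"
  shows "rat_eval (Fract p q) s = poly (cpoly p) s / poly (cpoly q) s"
proof -
  have "q \<noteq> 0" using assms by auto
  then obtain d where d: "p = num_of (Fract p q) * d" "q = den_of (Fract p q) * d"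
    by (rule Fract_num_denE[of q p])
  have "poly (cpoly p) s = poly (cpoly (num_of (Fract p q))) s * poly (cpoly d) s"
    "poly (cpoly q) s = poly (cpoly (den_of (Fract p q))) s * poly (cpoly d) s"
    using d by (metis cpoly_mult poly_mult)+
  with assms show ?thesis by (auto simp: rat_eval_def)
qed

text \<open>Membership in \<open>stable_rats\<close> can be tested on any representation as a fraction, not only on
  the reduced one.\<close>

lemma stable_ratsI:
  assumes "hurwitz q" "degree p \<le> degree q"
  shows "Fract p q \<in> stable_rats"
proof -
  have "q \<noteq> 0" using assms hurwitz_nonzero by blast
  then obtain d where d: "p = num_of (Fract p q) * d" "q = den_of (Fract p q) * d" "d \<noteq> 0"
    by (rule Fract_num_denE[of q p])
  have "degree (num_of (Fract p q)) \<le> degree (den_of (Fract p q))"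
  proof (cases "num_of (Fract p q) = 0")
    case False
    then have "degree p = degree (num_of (Fract p q)) + degree d"
      using d degree_mult_eq by metis
    moreover have "degree q = degree (den_of (Fract p q)) + degree d"
      using d degree_mult_eq den_nonzero by metis
    ultimately show ?thesis using assms by linarith
  qed simp
  moreover have "Re s < 0" if "poly (cpoly (den_of (Fract p q))) s = 0" for s
  proof -
    have "poly (cpoly q) s = 0"
      using that d(2) by (metis cpoly_mult poly_mult mult_zero_left)
    with assms show ?thesis by (auto simp: hurwitz_def)
  qed
  ultimately show ?thesis by (simp add: stable_rats_def rat_proper_def rat_stable_def)
qed

lemma stable_ratsE:
  assumes "r \<in> stable_rats"
  obtains p q where "r = Fract p q" "hurwitz q" "degree p \<le> degree q"
proof (rule that)
  show "r = Fract (num_of r) (den_of r)" by (simp add: Fract_num_den)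
qed (use assms in \<open>auto simp: hurwitz_def rat_proper_def rat_stable_def stable_rats_def\<close>)

lemma stable_rats_const: "Fract [:c:] 1 \<in> stable_rats"
  by (rule stable_ratsI) (auto simp: hurwitz_def)

lemma rat_eval_const: "rat_eval (Fract [:c:] 1) s = complex_of_real c"
  by (subst rat_eval_Fract) (auto simp: map_poly_pCons)

lemma stable_rats_add:
  assumes "a \<in> stable_rats" "b \<in> stable_rats"
  shows "a + b \<in> stable_rats"
    and "Re s \<ge> 0 \<Longrightarrow> rat_eval (a + b) s = rat_eval a s + rat_eval b s"
proof -
  obtain p q where a: "a = Fract p q" "hurwitz q" "degree p \<le> degree q"
    by (rule stable_ratsE[OF assms(1)])
  obtain p' q' where b: "b = Fract p' q'" "hurwitz q'" "degree p' \<le> degree q'"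
    by (rule stable_ratsE[OF assms(2)])
  have q: "q \<noteq> 0" "q' \<noteq> 0" using a b hurwitz_nonzero by auto
  have ab: "a + b = Fract (p * q' + p' * q) (q * q')" using a b q by simp
  have "degree (p * q' + p' * q) \<le> degree (q * q')"
    using a(3) b(3) q degree_mult_le[of p q'] degree_mult_le[of p' q]
    by (intro degree_add_le) (auto simp: degree_mult_eq)
  then show "a + b \<in> stable_rats"
    unfolding ab using a b by (intro stable_ratsI hurwitz_mult)
  assume "Re s \<ge> 0"
  then have nz: "poly (cpoly q) s \<noteq> 0" "poly (cpoly q') s \<noteq> 0"
    using a b hurwitz_poly_nonzero by auto
  then have "poly (cpoly (q * q')) s \<noteq> 0" by (simp add: cpoly_mult)
  then show "rat_eval (a + b) s = rat_eval a s + rat_eval b s"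
    unfolding ab using nz
    by (simp only: a(1) b(1) rat_eval_Fract cpoly_mult cpoly_add poly_mult poly_add add_frac_eq not_False_eq_True)
qed

lemma stable_rats_mult:
  assumes "a \<in> stable_rats" "b \<in> stable_rats"
  shows "a * b \<in> stable_rats"
    and "Re s \<ge> 0 \<Longrightarrow> rat_eval (a * b) s = rat_eval a s * rat_eval b s"
proof -
  obtain p q where a: "a = Fract p q" "hurwitz q" "degree p \<le> degree q"
    by (rule stable_ratsE[OF assms(1)])
  obtain p' q' where b: "b = Fract p' q'" "hurwitz q'" "degree p' \<le> degree q'"
    by (rule stable_ratsE[OF assms(2)])
  have q: "q \<noteq> 0" "q' \<noteq> 0" using a b hurwitz_nonzero by auto
  have ab: "a * b = Fract (p * p') (q * q')" using a b by simp
  have "degree (p * p') \<le> degree (q * q')"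
    using a(3) b(3) q degree_mult_le[of p p'] by (simp add: degree_mult_eq)
  then show "a * b \<in> stable_rats"
    unfolding ab using a b by (intro stable_ratsI hurwitz_mult)
  assume "Re s \<ge> 0"
  then have "poly (cpoly q) s \<noteq> 0" "poly (cpoly q') s \<noteq> 0"
    using a b hurwitz_poly_nonzero by auto
  then show "rat_eval (a * b) s = rat_eval a s * rat_eval b s"
    unfolding ab by (simp add: a b rat_eval_Fract cpoly_mult)
qed

lemma rat_eval_cnj: "rat_eval r (cnj s) = cnj (rat_eval r s)"
  by (simp add: rat_eval_def poly_cpoly_cnj)

lemma rat_eval_holomorphic:
  assumes "r \<in> stable_rats"
  shows "rat_eval r holomorphic_on {s. Re s > 0}"
proof -
  have "poly (cpoly (den_of r)) s \<noteq> 0" if "Re s > 0" for s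
    using assms that by (force simp: stable_rats_def rat_stable_def)
  then show ?thesis
    unfolding rat_eval_def by (intro holomorphic_intros) auto
qed

lemma rat_eval_continuous:
  assumes "r \<in> stable_rats"
  shows "continuous_on {s. Re s \<ge> 0} (rat_eval r)"
proof -
  have "poly (cpoly (den_of r)) s \<noteq> 0" if "Re s \<ge> 0" for s
    using assms that by (force simp: stable_rats_def rat_stable_def)
  then show ?thesis
    unfolding rat_eval_def by (intro continuous_intros) auto
qed

text \<open>The value at infinity; it is a limit along the filter \<open>at_infinity\<close>, that is, for
  \<open>|s| \<rightarrow> \<infinity>\<close> in any direction.\<close>

definition rat_at_inf :: "real poly fract \<Rightarrow> complex" where
  "rat_at_inf r = Lim at_infinity (rat_eval r)"

lemma rat_proper_tendsto:
  assumes "rat_proper r"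
  defines "n \<equiv> degree (den_of r)"
  shows "(rat_eval r \<longlongrightarrow> complex_of_real (coeff (num_of r) n / coeff (den_of r) n)) at_infinity"
proof -
  let ?f = "\<lambda>s. (poly (cpoly (num_of r)) s / s ^ n) / (poly (cpoly (den_of r)) s / s ^ n)"
  have "coeff (den_of r) n \<noteq> 0" using den_nonzero by (simp add: n_def)
  then have "(?f \<longlongrightarrow> coeff (cpoly (num_of r)) n / coeff (cpoly (den_of r)) n) at_infinity"
    using assms
    by (intro tendsto_divide poly_over_power_tendsto)
       (auto simp: degree_cpoly rat_proper_def coeff_map_poly)
  moreover have "eventually (\<lambda>s. ?f s = rat_eval r s) at_infinity"
    by (rule eventually_at_infinityI[of 1]) (auto simp: rat_eval_def)
  ultimately show ?thesis
    by (simp add: tendsto_cong coeff_map_poly)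
qed

lemma rat_at_inf_eq:
  assumes "rat_proper r"
  shows "rat_at_inf r =
    complex_of_real (coeff (num_of r) (degree (den_of r)) / coeff (den_of r) (degree (den_of r)))"
  unfolding rat_at_inf_def
  by (intro tendsto_Lim rat_proper_tendsto assms trivial_limit_at_infinity)

lemma rat_at_inf_tendsto:
  assumes "r \<in> stable_rats"
  shows "(rat_eval r \<longlongrightarrow> rat_at_inf r) at_infinity"
  using assms rat_proper_tendsto[of r] rat_at_inf_eq[of r] by (simp add: stable_rats_def)

lemma rat_at_inf_real: "r \<in> stable_rats \<Longrightarrow> cnj (rat_at_inf r) = rat_at_inf r"
  by (simp add: rat_at_inf_eq stable_rats_def)

text \<open>Evaluation is additive and multiplicative only in the closed right half plane, because
  \<open>rat_eval\<close> takes default values at poles. The value at infinity is therefore identified along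
  the positive real axis, on which the ring operations commute with evaluation.\<close>

lemma rat_at_inf_eqI:
  assumes "r \<in> stable_rats" "((\<lambda>x. rat_eval r (complex_of_real x)) \<longlongrightarrow> l) at_top"
  shows "rat_at_inf r = l"
proof -
  have "((\<lambda>x. rat_eval r (complex_of_real x)) \<longlongrightarrow> rat_at_inf r) at_top"
    by (rule filterlim_compose[OF rat_at_inf_tendsto[OF assms(1)] filterlim_of_real_at_infinity])
  then show ?thesis using assms(2) tendsto_unique trivial_limit_at_top_linorder by blast
qed

lemma rat_at_inf_tendsto_real:
  assumes "r \<in> stable_rats"
  shows "((\<lambda>x. rat_eval r (complex_of_real x)) \<longlongrightarrow> rat_at_inf r) at_top"
  by (rule filterlim_compose[OF rat_at_inf_tendsto[OF assms(1)] filterlim_of_real_at_infinity])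

lemma rat_at_inf_add:
  assumes "a \<in> stable_rats" "b \<in> stable_rats"
  shows "rat_at_inf (a + b) = rat_at_inf a + rat_at_inf b"
proof (rule rat_at_inf_eqI)
  have "((\<lambda>x. rat_eval a (complex_of_real x) + rat_eval b (complex_of_real x))
    \<longlongrightarrow> rat_at_inf a + rat_at_inf b) at_top"
    using assms by (intro tendsto_add rat_at_inf_tendsto_real)
  moreover have "eventually (\<lambda>x. rat_eval a (complex_of_real x) + rat_eval b (complex_of_real x)
      = rat_eval (a + b) (complex_of_real x)) at_top"
    using eventually_ge_at_top[of 0] by eventually_elim (simp add: stable_rats_add assms)
  ultimately show "((\<lambda>x. rat_eval (a + b) (complex_of_real x))
    \<longlongrightarrow> rat_at_inf a + rat_at_inf b) at_top"
    by (rule Lim_transform_eventually)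
qed (simp add: assms stable_rats_add)

lemma rat_at_inf_mult:
  assumes "a \<in> stable_rats" "b \<in> stable_rats"
  shows "rat_at_inf (a * b) = rat_at_inf a * rat_at_inf b"
proof (rule rat_at_inf_eqI)
  have "((\<lambda>x. rat_eval a (complex_of_real x) * rat_eval b (complex_of_real x))
    \<longlongrightarrow> rat_at_inf a * rat_at_inf b) at_top"
    using assms by (intro tendsto_mult rat_at_inf_tendsto_real)
  moreover have "eventually (\<lambda>x. rat_eval a (complex_of_real x) * rat_eval b (complex_of_real x)
      = rat_eval (a * b) (complex_of_real x)) at_top"
    using eventually_ge_at_top[of 0] by eventually_elim (simp add: stable_rats_mult assms)
  ultimately show "((\<lambda>x. rat_eval (a * b) (complex_of_real x))
    \<longlongrightarrow> rat_at_inf a * rat_at_inf b) at_top"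
    by (rule Lim_transform_eventually)
qed (simp add: assms stable_rats_mult)

lemma rat_at_inf_const: "rat_at_inf (Fract [:c:] 1) = complex_of_real c"
  by (rule rat_at_inf_eqI) (auto simp: stable_rats_const rat_eval_const)

lemma stable_rats_inverse:
  assumes "r \<in> stable_rats" "\<And>s. Re s \<ge> 0 \<Longrightarrow> rat_eval r s \<noteq> 0" "rat_at_inf r \<noteq> 0"
  shows "inverse r \<in> stable_rats"
proof -
  have "hurwitz (num_of r)"
    unfolding hurwitz_def using assms(2) by (metis div_0 not_less rat_eval_def)
  moreover have "coeff (num_of r) (degree (den_of r)) \<noteq> 0"
    using assms(1,3) by (auto simp: rat_at_inf_eq stable_rats_def)
  then have "degree (den_of r) \<le> degree (num_of r)" by (rule le_degree)
  ultimately have "Fract (den_of r) (num_of r) \<in> stable_rats" by (rule stable_ratsI)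
  then show ?thesis by (metis inverse_fract Fract_num_den)
qed

text \<open>The quotients \<open>(r(s) - r(0)) / s\<close> and \<open>s (r(s) - r(\<infinity>))\<close> are again proper and stable: the
  zero of the numerator at the origin cancels \<open>s\<close>, and subtracting the value at infinity lowers
  the degree of the numerator by one.\<close>

lemma stable_rats_quotient_zero:
  assumes "r \<in> stable_rats"
  obtains g where "g \<in> stable_rats"
    "\<And>s. Re s \<ge> 0 \<Longrightarrow> s * rat_eval g s = rat_eval r s - rat_eval r 0"
proof -
  obtain p q where r: "r = Fract p q" "hurwitz q" "degree p \<le> degree q"
    by (rule stable_ratsE[OF assms])
  define c where "c = poly p 0 / poly q 0"
  have at0: "poly (cpoly t) 0 = complex_of_real (poly t 0)" for t
    by (simp add: poly_0_coeff_0 coeff_map_poly)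
  have q0: "poly q 0 \<noteq> 0" using hurwitz_poly_nonzero[OF r(2), of 0] at0[of q] by auto
  have "poly (p - smult c q) 0 = 0" using q0 by (simp add: c_def)
  then have "[:0, 1:] dvd p - smult c q" by (subst (asm) poly_eq_0_iff_dvd) simp
  then obtain t where t: "p - smult c q = [:0, 1:] * t" by (elim dvdE)
  have "degree t \<le> degree q"
  proof (cases "t = 0")
    case False
    then have "Suc (degree t) = degree (p - smult c q)" unfolding t by (subst degree_mult_eq) auto
    also have "\<dots> \<le> degree q" using r(3) by (intro degree_diff_le) (auto intro: order_trans degree_smult_le)
    finally show ?thesis by simp
  qed simp
  then have "Fract t q \<in> stable_rats" by (intro stable_ratsI r)
  moreover have "s * rat_eval (Fract t q) s = rat_eval r s - rat_eval r 0" if "Re s \<ge> 0" for s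
  proof -
    have nz: "poly (cpoly q) s \<noteq> 0" "poly (cpoly q) 0 \<noteq> 0" using that r hurwitz_poly_nonzero by auto
    have "p = smult c q + [:0, 1:] * t" using t by (simp add: algebra_simps)
    then have P: "poly (cpoly p) s = c * poly (cpoly q) s + s * poly (cpoly t) s"
      by (simp add: cpoly_add cpoly_smult cpoly_mult map_poly_pCons)
    have C: "rat_eval r 0 = c"
      using nz by (simp add: r(1) rat_eval_Fract at0 c_def)
    have E: "rat_eval r s = poly (cpoly p) s / poly (cpoly q) s"
      "rat_eval (Fract t q) s = poly (cpoly t) s / poly (cpoly q) s"
      using nz by (simp_all add: r(1) rat_eval_Fract)
    show ?thesis unfolding E C P using nz by (simp only: add_divide_distrib) simp
  qed
  ultimately show ?thesis by (rule that)
qed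

lemma stable_rats_quotient_inf:
  assumes "r \<in> stable_rats"
  obtains g where "g \<in> stable_rats"
    "\<And>s. Re s \<ge> 0 \<Longrightarrow> rat_eval g s = s * (rat_eval r s - rat_at_inf r)"
proof -
  define p q where "p = num_of r" and "q = den_of r"
  define c where "c = coeff p (degree q) / coeff q (degree q)"
  have h: "hurwitz q" and deg: "degree p \<le> degree q"
    using assms by (auto simp: stable_rats_def rat_stable_def rat_proper_def hurwitz_def p_def q_def)
  have q: "q \<noteq> 0" by (simp add: q_def den_nonzero)
  define t where "t = p - smult c q"
  have "degree ([:0, 1:] * t) \<le> degree q"
  proof (cases "t = 0")
    case False
    have "degree t \<le> degree q" unfolding t_def
      using deg by (intro degree_diff_le) (auto intro: order_trans degree_smult_le)
    moreover have "coeff t (degree q) = 0" using q by (simp add: t_def c_def)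
    ultimately have "degree t < degree q"
      using False by (metis leading_coeff_0_iff le_neq_implies_less)
    then show ?thesis using False by (subst degree_mult_eq) auto
  qed simp
  then have "Fract ([:0, 1:] * t) q \<in> stable_rats" by (intro stable_ratsI h)
  moreover have "rat_eval (Fract ([:0, 1:] * t) q) s = s * (rat_eval r s - rat_at_inf r)"
    if "Re s \<ge> 0" for s
  proof -
    have nz: "poly (cpoly q) s \<noteq> 0" using that h hurwitz_poly_nonzero by auto
    have "p = smult c q + t" by (simp add: t_def)
    then have P: "poly (cpoly p) s = c * poly (cpoly q) s + poly (cpoly t) s"
      by (simp add: cpoly_add cpoly_smult)
    have C: "rat_at_inf r = c"
      using assms by (simp add: rat_at_inf_eq stable_rats_def c_def p_def q_def)
    have E: "rat_eval r s = poly (cpoly p) s / poly (cpoly q) s"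
      by (simp add: rat_eval_def p_def q_def)
    have T: "rat_eval (Fract ([:0, 1:] * t) q) s = s * poly (cpoly t) s / poly (cpoly q) s"
      by (subst rat_eval_Fract[OF nz]) (simp only: cpoly_mult poly_mult, simp add: map_poly_pCons)
    show ?thesis unfolding T E C P using nz by (simp only: add_divide_distrib) simp
  qed
  ultimately show ?thesis by (rule that)
qed

section \<open>Matrices over a subring and evaluation homomorphisms\<close>

text \<open>A unital ring homomorphism that is only defined on a subring \<open>S\<close>. Evaluation at a point of
  the closed right half plane, or at infinity, is of this kind.\<close>

locale partial_ring_hom =
  fixes S :: "'a::comm_ring_1 set" and h :: "'a \<Rightarrow> 'b::comm_ring_1"
  assumes one_mem: "1 \<in> S" and uminus_one_mem: "- 1 \<in> S"
    and add_mem: "a \<in> S \<Longrightarrow> b \<in> S \<Longrightarrow> a + b \<in> S"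
    and mult_mem: "a \<in> S \<Longrightarrow> b \<in> S \<Longrightarrow> a * b \<in> S"
    and hom_one: "h 1 = 1"
    and hom_add: "a \<in> S \<Longrightarrow> b \<in> S \<Longrightarrow> h (a + b) = h a + h b"
    and hom_mult: "a \<in> S \<Longrightarrow> b \<in> S \<Longrightarrow> h (a * b) = h a * h b"
begin

lemma zero_mem: "0 \<in> S"
  using add_mem[OF one_mem uminus_one_mem] by simp

lemma hom_zero: "h 0 = 0"
  using hom_add[OF zero_mem zero_mem] by simp

lemma hom_uminus_one: "h (- 1) = - 1"
  using hom_add[OF one_mem uminus_one_mem] hom_zero hom_one
  by (simp add: eq_neg_iff_add_eq_0 add.commute)

lemma sum_mem_hom:
  assumes "\<And>i. i \<in> I \<Longrightarrow> f i \<in> S"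
  shows "sum f I \<in> S \<and> h (sum f I) = (\<Sum>i\<in>I. h (f i))"
  using assms by (induction I rule: infinite_finite_induct)
    (auto simp: zero_mem hom_zero add_mem hom_add)

lemma prod_mem_hom:
  assumes "\<And>i. i \<in> I \<Longrightarrow> f i \<in> S"
  shows "prod f I \<in> S \<and> h (prod f I) = (\<Prod>i\<in>I. h (f i))"
  using assms by (induction I rule: infinite_finite_induct)
    (auto simp: one_mem hom_one mult_mem hom_mult)

lemma sign_mem_hom: "of_int (sign p) \<in> S \<and> h (of_int (sign p)) = of_int (sign p)"
  by (simp add: sign_def one_mem hom_one uminus_one_mem hom_uminus_one)

lemma det_mem_hom:
  fixes A :: "'a ^ 'n ^ 'n"
  assumes "\<And>i j. A $ i $ j \<in> S"
  shows "det A \<in> S \<and> h (det A) = det (map_matrix h A)"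
proof -
  let ?t = "\<lambda>p. of_int (sign p) * (\<Prod>i\<in>UNIV. A $ i $ p i)"
  have "?t p \<in> S \<and> h (?t p) = of_int (sign p) * (\<Prod>i\<in>UNIV. h (A $ i $ p i))" for p
    using sign_mem_hom[of p] prod_mem_hom[of UNIV "\<lambda>i. A $ i $ p i"] assms
    by (simp add: mult_mem hom_mult)
  then show ?thesis
    using sum_mem_hom[of "{p. p permutes UNIV}" ?t] unfolding det_def by simp
qed

lemma matrix_mult_mem_hom:
  fixes A :: "'a ^ 'n ^ 'm" and B :: "'a ^ 'k ^ 'n"
  assumes "\<And>i j. A $ i $ j \<in> S" "\<And>i j. B $ i $ j \<in> S"
  shows "(A ** B) $ i $ j \<in> S" "map_matrix h (A ** B) = map_matrix h A ** map_matrix h B"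
proof -
  have *: "(A ** B) $ i $ j \<in> S \<and> h ((A ** B) $ i $ j) = (\<Sum>k\<in>UNIV. h (A $ i $ k) * h (B $ k $ j))"
    for i j
    using sum_mem_hom[of UNIV "\<lambda>k. A $ i $ k * B $ k $ j"] assms
    by (simp add: matrix_matrix_mult_def mult_mem hom_mult)
  then show "(A ** B) $ i $ j \<in> S" by blast
  from * show "map_matrix h (A ** B) = map_matrix h A ** map_matrix h B"
    by (simp add: vec_eq_iff) (simp add: matrix_matrix_mult_def)
qed

lemma map_matrix_add_hom:
  fixes A B :: "'a ^ 'n ^ 'm"
  assumes "\<And>i j. A $ i $ j \<in> S" "\<And>i j. B $ i $ j \<in> S"
  shows "map_matrix h (A + B) = map_matrix h A + map_matrix h B"
  using assms by (simp add: vec_eq_iff hom_add)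

lemma map_matrix_one_hom: "map_matrix h (mat 1) = mat 1"
  by (simp add: vec_eq_iff mat_def hom_zero hom_one)

lemma uminus_mem: "a \<in> S \<Longrightarrow> - a \<in> S"
  using mult_mem[OF uminus_one_mem] by fastforce

lemma hom_diff: "a \<in> S \<Longrightarrow> b \<in> S \<Longrightarrow> h (a - b) = h a - h b"
  using hom_add[of "a - b" b] add_mem[of a "- b"] uminus_mem by simp

lemma map_matrix_diff_hom:
  fixes A B :: "'a ^ 'n ^ 'm"
  assumes "\<And>i j. A $ i $ j \<in> S" "\<And>i j. B $ i $ j \<in> S"
  shows "map_matrix h (A - B) = map_matrix h A - map_matrix h B"
  using assms by (simp add: vec_eq_iff hom_diff)

end

lemma one_fract_const: "1 = Fract [:1:] (1 :: real poly)"
  by (simp add: One_fract_def flip: one_pCons)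

lemma uminus_one_fract_const: "- 1 = Fract [:- 1:] (1 :: real poly)"
  by (simp add: One_fract_def one_pCons)

lemma rat_eval_hom: "Re s \<ge> 0 \<Longrightarrow> partial_ring_hom stable_rats (\<lambda>r. rat_eval r s)"
  using stable_rats_const[of 1] stable_rats_const[of "- 1"] rat_eval_const[of 1 s]
  by unfold_locales
     (auto simp: stable_rats_add stable_rats_mult one_fract_const uminus_one_fract_const)

lemma rat_at_inf_hom: "partial_ring_hom stable_rats rat_at_inf"
  using stable_rats_const[of 1] stable_rats_const[of "- 1"] rat_at_inf_const[of 1]
  by unfold_locales
     (auto simp: stable_rats_add stable_rats_mult rat_at_inf_add rat_at_inf_mult
        one_fract_const uminus_one_fract_const)

lemma RH_inf_entry: "R \<in> RH_inf \<Longrightarrow> R $ i $ j \<in> stable_rats" for R :: "('n::finite) tfm"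
  by (simp add: RH_inf_iff)

lemma tf_at_inf_tendsto:
  assumes "R \<in> RH_inf"
  shows "(tf_eval R \<longlongrightarrow> map_matrix rat_at_inf R) at_infinity"
proof -
  have "((\<lambda>s. \<chi> i j. rat_eval (R $ i $ j) s) \<longlongrightarrow> (\<chi> i j. rat_at_inf (R $ i $ j))) at_infinity"
    using assms by (intro tendsto_vec_lambda rat_at_inf_tendsto) (simp add: RH_inf_iff)
  then show ?thesis by (simp add: tf_eval_def[abs_def] map_matrix_def)
qed

lemma tf_at_inf_eq: "R \<in> RH_inf \<Longrightarrow> tf_at_inf R = map_matrix rat_at_inf R"
  unfolding tf_at_inf_def
  by (intro tendsto_Lim tf_at_inf_tendsto trivial_limit_at_infinity)

lemma RH_inf_mult:
  fixes A B :: "('n::finite) tfm"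
  assumes "A \<in> RH_inf" "B \<in> RH_inf"
  shows "A ** B \<in> RH_inf"
    and "Re s \<ge> 0 \<Longrightarrow> tf_eval (A ** B) s = tf_eval A s ** tf_eval B s"
    and "tf_at_inf (A ** B) = tf_at_inf A ** tf_at_inf B"
proof -
  interpret partial_ring_hom stable_rats rat_at_inf by (rule rat_at_inf_hom)
  show *: "A ** B \<in> RH_inf"
    using matrix_mult_mem_hom(1)[of A B] assms by (simp add: RH_inf_iff)
  show "tf_at_inf (A ** B) = tf_at_inf A ** tf_at_inf B"
    using matrix_mult_mem_hom(2)[of A B] * assms by (simp add: tf_at_inf_eq) (simp add: RH_inf_iff)
  assume "Re s \<ge> 0"
  then interpret s: partial_ring_hom stable_rats "\<lambda>r. rat_eval r s" by (rule rat_eval_hom)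
  show "tf_eval (A ** B) s = tf_eval A s ** tf_eval B s"
    using s.matrix_mult_mem_hom(2)[of A B] assms by (simp add: tf_eval_def RH_inf_iff)
qed

lemma RH_inf_add:
  fixes A B :: "('n::finite) tfm"
  assumes "A \<in> RH_inf" "B \<in> RH_inf"
  shows "A + B \<in> RH_inf"
    and "Re s \<ge> 0 \<Longrightarrow> tf_eval (A + B) s = tf_eval A s + tf_eval B s"
    and "tf_at_inf (A + B) = tf_at_inf A + tf_at_inf B"
proof -
  interpret partial_ring_hom stable_rats rat_at_inf by (rule rat_at_inf_hom)
  show *: "A + B \<in> RH_inf"
    using add_mem assms by (simp add: RH_inf_iff)
  show "tf_at_inf (A + B) = tf_at_inf A + tf_at_inf B"
    using map_matrix_add_hom[of A B] * assms by (simp add: tf_at_inf_eq) (simp add: RH_inf_iff)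
  assume "Re s \<ge> 0"
  then interpret s: partial_ring_hom stable_rats "\<lambda>r. rat_eval r s" by (rule rat_eval_hom)
  show "tf_eval (A + B) s = tf_eval A s + tf_eval B s"
    using s.map_matrix_add_hom[of A B] assms by (simp add: tf_eval_def RH_inf_iff)
qed

lemma RH_inf_diff:
  fixes A B :: "('n::finite) tfm"
  assumes "A \<in> RH_inf" "B \<in> RH_inf"
  shows "A - B \<in> RH_inf"
    and "Re s \<ge> 0 \<Longrightarrow> tf_eval (A - B) s = tf_eval A s - tf_eval B s"
    and "tf_at_inf (A - B) = tf_at_inf A - tf_at_inf B"
proof -
  interpret partial_ring_hom stable_rats rat_at_inf by (rule rat_at_inf_hom)
  have "a - b \<in> stable_rats" if "a \<in> stable_rats" "b \<in> stable_rats" for a b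
    using add_mem[OF that(1) uminus_mem[OF that(2)]] by simp
  then show *: "A - B \<in> RH_inf"
    using assms by (simp add: RH_inf_iff)
  show "tf_at_inf (A - B) = tf_at_inf A - tf_at_inf B"
    using map_matrix_diff_hom[of A B] * assms by (simp add: tf_at_inf_eq) (simp add: RH_inf_iff)
  assume "Re s \<ge> 0"
  then interpret s: partial_ring_hom stable_rats "\<lambda>r. rat_eval r s" by (rule rat_eval_hom)
  show "tf_eval (A - B) s = tf_eval A s - tf_eval B s"
    using s.map_matrix_diff_hom[of A B] assms by (simp add: tf_eval_def RH_inf_iff)
qed

lemma RH_inf_one:
  defines "I \<equiv> (mat 1 :: ('n::finite) tfm)"
  shows "I \<in> RH_inf" "Re s \<ge> 0 \<Longrightarrow> tf_eval I s = mat 1" "tf_at_inf I = mat 1"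
proof -
  interpret partial_ring_hom stable_rats rat_at_inf by (rule rat_at_inf_hom)
  show *: "I \<in> RH_inf" by (simp add: I_def RH_inf_iff mat_def zero_mem one_mem)
  show "tf_at_inf I = mat 1" using map_matrix_one_hom * by (simp add: tf_at_inf_eq I_def)
  assume "Re s \<ge> 0"
  then interpret s: partial_ring_hom stable_rats "\<lambda>r. rat_eval r s" by (rule rat_eval_hom)
  show "tf_eval I s = mat 1" using s.map_matrix_one_hom by (simp add: tf_eval_def I_def)
qed

lemma RH_inf_scalar:
  fixes c :: real
  defines "C \<equiv> (mat (Fract [:c:] 1) :: ('n::finite) tfm)"
  shows "C \<in> RH_inf" "Re s \<ge> 0 \<Longrightarrow> tf_eval C s = mat (complex_of_real c)"
    "tf_at_inf C = mat (complex_of_real c)"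
proof -
  interpret partial_ring_hom stable_rats rat_at_inf by (rule rat_at_inf_hom)
  show *: "C \<in> RH_inf" by (simp add: C_def RH_inf_iff mat_def zero_mem stable_rats_const)
  show "tf_at_inf C = mat (complex_of_real c)"
    using * by (simp add: tf_at_inf_eq) (simp add: C_def vec_eq_iff mat_def hom_zero rat_at_inf_const)
  assume "Re s \<ge> 0"
  then interpret s: partial_ring_hom stable_rats "\<lambda>r. rat_eval r s" by (rule rat_eval_hom)
  show "tf_eval C s = mat (complex_of_real c)"
    by (simp add: C_def tf_eval_def vec_eq_iff mat_def s.hom_zero rat_eval_const)
qed

lemma RH_inf_uminus:
  fixes Q :: "('n::finite) tfm"
  assumes "Q \<in> RH_inf"
  shows "- Q \<in> RH_inf" "Re s \<ge> 0 \<Longrightarrow> tf_eval (- Q) s = - tf_eval Q s"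
proof -
  let ?Z = "mat (Fract [:0:] 1) :: 'n tfm"
  have "?Z = 0" by (simp add: vec_eq_iff mat_def Zero_fract_def)
  then have "- Q = ?Z - Q" by simp
  moreover have "mat (complex_of_real 0) = (0 :: complex ^ 'n ^ 'n)"
    by (simp add: vec_eq_iff mat_def)
  ultimately show "- Q \<in> RH_inf" "Re s \<ge> 0 \<Longrightarrow> tf_eval (- Q) s = - tf_eval Q s"
    using RH_inf_diff[OF RH_inf_scalar(1)[of 0] assms] RH_inf_scalar(2)[of s 0, where 'n = 'n] by simp_all
qed

text \<open>A transfer matrix that is invertible at every point of the closed right half plane and at
  infinity has its inverse in \<open>RH_inf\<close>: by Cramer's rule the entries of the inverse are
  determinants over \<open>stable_rats\<close>, divided by a unit of \<open>stable_rats\<close>.\<close>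

lemma RH_inf_inverse:
  fixes Q :: "('n::finite) tfm"
  assumes Q: "Q \<in> RH_inf" and inv: "\<And>s. Re s \<ge> 0 \<Longrightarrow> invertible (tf_eval Q s)"
    and inf: "invertible (tf_at_inf Q)"
  obtains W where "W \<in> RH_inf" "Q ** W = mat 1" "W ** Q = mat 1"
proof -
  interpret inf: partial_ring_hom stable_rats rat_at_inf by (rule rat_at_inf_hom)
  have ev: "rat_eval (det Q) s \<noteq> 0" if "Re s \<ge> 0" for s
  proof -
    interpret s: partial_ring_hom stable_rats "\<lambda>r. rat_eval r s" using that by (rule rat_eval_hom)
    show ?thesis using s.det_mem_hom[of Q] Q inv[OF that]
      by (simp add: RH_inf_iff tf_eval_def invertible_det_nz)
  qed
  have "det Q \<in> stable_rats" using inf.det_mem_hom[of Q] Q by (simp add: RH_inf_iff)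
  moreover have "rat_at_inf (det Q) \<noteq> 0"
    using inf.det_mem_hom[of Q] Q inf
    by (simp add: tf_at_inf_eq[OF Q] invertible_det_nz) (simp add: RH_inf_iff)
  ultimately have di: "inverse (det Q) \<in> stable_rats" using ev by (intro stable_rats_inverse)
  have "det Q \<noteq> 0"
    using ev[of 0] by (auto simp: rat_eval_def num_of_def)
  then obtain W where W: "Q ** W = mat 1" "W ** Q = mat 1"
    using invertible_det_nz invertible_def by metis
  have "W $ k $ j \<in> stable_rats" for k j
  proof -
    let ?b = "column j (mat 1 :: 'n tfm)"
    let ?C = "\<chi> i l. if l = k then ?b $ i else Q $ i $ l"
    have "Q *v column j W = ?b"
      by (simp flip: W(1) add: vec_eq_iff column_def matrix_matrix_mult_def matrix_vector_mult_def)
    then have "W $ k $ j = det ?C / det Q"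
      using cramer[OF \<open>det Q \<noteq> 0\<close>, of "column j W" ?b] by (simp add: vec_eq_iff column_def)
    moreover have "?C $ i $ l \<in> stable_rats" for i l
      using Q by (simp add: RH_inf_iff column_def mat_def inf.zero_mem inf.one_mem)
    then have "det ?C \<in> stable_rats" using inf.det_mem_hom by blast
    ultimately show ?thesis
      using di stable_rats_mult by (simp add: divide_inverse)
  qed
  then have "W \<in> RH_inf" by (simp add: RH_inf_iff)
  then show ?thesis using that W by blast
qed

section \<open>Harmonic functions on the right half plane\<close>

text \<open>The minimum principle for the real part of a function that is holomorphic on the open right
  half plane, continuous up to the imaginary axis and convergent at infinity. The
  boundary condition is needed only away from the origin; continuity extends it.\<close>

lemma half_plane_Re_nonneg:
  assumes cont: "continuous_on {s. Re s \<ge> 0} f" and holo: "f holomorphic_on {s. Re s > 0}"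
    and lim: "(f \<longlongrightarrow> L) at_infinity"
    and axis: "\<And>w. w \<noteq> 0 \<Longrightarrow> Re (f (\<i> * complex_of_real w)) \<ge> 0"
    and s: "Re s \<ge> 0"
  shows "Re (f s) \<ge> 0"
proof -
  have path: "((\<lambda>w. \<i> * complex_of_real w) \<longlongrightarrow> 0) (at_right 0)"
    by (rule tendsto_eq_intros refl | simp)+
  have "((\<lambda>w. Re (f (\<i> * complex_of_real w))) \<longlongrightarrow> Re (f 0)) (at_right 0)"
    by (intro tendsto_Re continuous_on_tendsto_compose[OF cont path]) auto
  moreover have "eventually (\<lambda>w. 0 \<le> Re (f (\<i> * complex_of_real w))) (at_right 0)"
    using eventually_at_right_less[of "0::real"] by eventually_elim (simp add: axis)
  ultimately have "Re (f 0) \<ge> 0"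
    by (intro tendsto_lowerbound) auto
  then have axis': "Re (f (\<i> * complex_of_real w)) \<ge> 0" for w
    using axis[of w] by (cases "w = 0") auto
  have "filterlim (\<lambda>w. \<i> * complex_of_real w) at_infinity at_top"
    by (intro tendsto_mult_filterlim_at_infinity[where c = \<i>] tendsto_const
        filterlim_of_real_at_infinity) auto
  then have "((\<lambda>w. Re (f (\<i> * complex_of_real w))) \<longlongrightarrow> Re L) at_top"
    by (intro tendsto_Re filterlim_compose[OF lim])
  then have "Re L \<ge> 0"
    using axis' by (intro tendsto_lowerbound) auto
  \<comment> \<open>The claim is that \<open>g\<close> has modulus at most 1; a bound by \<open>1 + e\<close> holds far away from the
      origin, and the maximum modulus principle applies to a large half disc.\<close>
  define g where "g z = exp (- f z)" for z
  have gn: "norm (g z) = exp (- Re (f z))" for z by (simp add: g_def)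
  have "norm (g s) \<le> 1 + e" if "e > 0" for e
  proof -
    have "((\<lambda>z. norm (g z)) \<longlongrightarrow> exp (- Re L)) at_infinity"
      unfolding gn by (intro tendsto_intros lim)
    moreover have "exp (- Re L) < 1 + e" using \<open>Re L \<ge> 0\<close> \<open>e > 0\<close>
      by (smt (verit) exp_le_one_iff)
    ultimately have "eventually (\<lambda>z. norm (g z) < 1 + e) at_infinity"
      by (rule order_tendstoD(2))
    then obtain b where b: "\<And>z. norm z \<ge> b \<Longrightarrow> norm (g z) < 1 + e"
      by (auto simp: eventually_at_infinity)
    define r where "r = max 1 (max b (norm s + 1))"
    define D where "D = ball 0 r \<inter> {z. Re z > 0}"
    have "open D" unfolding D_def by (intro open_Int open_ball open_halfspace_Re_gt)
    have clD: "closure D \<subseteq> cball 0 r \<inter> {z. Re z \<ge> 0}"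
      by (rule closure_minimal) (auto simp: D_def closed_halfspace_Re_ge)
    have fr: "norm (g z) \<le> 1 + e" if "z \<in> frontier D" for z
    proof (cases "norm z \<ge> b")
      case True
      then show ?thesis using b less_imp_le by blast
    next
      case False
      then have "norm z < r" by (auto simp: r_def)
      moreover have "z \<in> closure D" "z \<notin> D"
        using that \<open>open D\<close> by (auto simp: frontier_def interior_open)
      ultimately have "Re z = 0" using clD by (auto simp: D_def)
      then have "z = \<i> * complex_of_real (Im z)" by (simp add: complex_eq_iff)
      then have "Re (f z) \<ge> 0" using axis' by metis
      then have "norm (g z) \<le> 1" by (simp add: gn)
      then show ?thesis using \<open>e > 0\<close> by linarith
    qed
    show ?thesis
    proof (cases "Re s > 0")
      case True
      then have "s \<in> D" by (auto simp: D_def r_def)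
      have "g holomorphic_on interior D" unfolding g_def
        by (intro holomorphic_intros holomorphic_on_subset[OF holo])
           (use interior_subset in \<open>auto simp: D_def\<close>)
      moreover have "continuous_on (closure D) g" unfolding g_def
        by (intro continuous_intros continuous_on_subset[OF cont]) (use clD in auto)
      moreover have "bounded D" by (simp add: D_def bounded_Int)
      ultimately show ?thesis
        using fr \<open>s \<in> D\<close> by (rule maximum_modulus_frontier)
    next
      case False
      then have "s = \<i> * complex_of_real (Im s)" using s by (simp add: complex_eq_iff)
      then have "Re (f s) \<ge> 0" using axis' by metis
      then have "norm (g s) \<le> 1" by (simp add: gn)
      then show ?thesis using \<open>e > 0\<close> by linarith
    qed
  qed
  then have "norm (g s) \<le> 1" by (rule field_le_epsilon)
  then show ?thesis by (simp add: gn)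
qed

text \<open>If the real part vanished at an interior point, \<open>exp (- f)\<close> would attain its maximal modulus
  there and be constant, contradicting the boundary condition at \<open>\<i>\<close>.\<close>

lemma half_plane_Re_pos:
  assumes cont: "continuous_on {s. Re s \<ge> 0} f" and holo: "f holomorphic_on {s. Re s > 0}"
    and lim: "(f \<longlongrightarrow> L) at_infinity"
    and axis: "\<And>w. w \<noteq> 0 \<Longrightarrow> Re (f (\<i> * complex_of_real w)) > 0"
    and s: "Re s > 0"
  shows "Re (f s) > 0"
proof (rule ccontr)
  assume "\<not> Re (f s) > 0"
  have nonneg: "Re (f z) \<ge> 0" if "Re z \<ge> 0" for z
    using half_plane_Re_nonneg[OF cont holo lim _ that] axis less_imp_le by blast
  define g where "g z = exp (- f z)" for z
  have gn: "norm (g z) = exp (- Re (f z))" for z by (simp add: g_def)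
  let ?H = "{z. Re z > 0}"
  have "g constant_on ?H"
  proof (rule maximum_modulus_principle)
    show "g holomorphic_on ?H" unfolding g_def by (intro holomorphic_intros holo)
    show "connected ?H" by (intro convex_connected convex_halfspace_Re_gt)
    show "norm (g z) \<le> norm (g s)" if "z \<in> ?H" for z
      using that nonneg[of z] \<open>\<not> Re (f s) > 0\<close> by (simp add: gn)
  qed (use s in \<open>auto simp: open_halfspace_Re_gt\<close>)
  then obtain c where c: "g z = c" if "Re z > 0" for z by (auto simp: constant_on_def)
  then have nc: "norm c \<ge> 1" using s \<open>\<not> Re (f s) > 0\<close> gn[of s] by auto
  have path: "((\<lambda>x. Complex x 1) \<longlongrightarrow> \<i>) (at_right 0)"
    unfolding Complex_eq by (rule tendsto_eq_intros refl | simp)+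
  have "((\<lambda>x. norm (g (Complex x 1))) \<longlongrightarrow> norm (g \<i>)) (at_right 0)"
    unfolding g_def
    by (intro tendsto_norm tendsto_exp tendsto_minus continuous_on_tendsto_compose[OF cont path])
       (auto intro: eventually_mono[OF eventually_at_right_less])
  moreover have "eventually (\<lambda>x. 1 \<le> norm (g (Complex x 1))) (at_right 0)"
    using eventually_at_right_less[of "0::real"] by eventually_elim (simp add: c nc)
  ultimately have "norm (g \<i>) \<ge> 1" by (intro tendsto_lowerbound) auto
  then show False using axis[of 1] by (simp add: gn)
qed

section \<open>Hermitian forms and eigenvalues of products\<close>

text \<open>The standard inner product on complex vectors, conjugate linear in the first argument.\<close>

definition cip :: "complex ^ 'n \<Rightarrow> complex ^ 'n \<Rightarrow> complex" where
  "cip x y = (\<Sum>i\<in>UNIV. cnj (x $ i) * y $ i)"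

lemma cip_add_left: "cip (x + y) z = cip x z + cip y z"
  by (simp add: cip_def sum.distrib algebra_simps)

lemma cip_add_right: "cip z (x + y) = cip z x + cip z y"
  by (simp add: cip_def sum.distrib algebra_simps)

lemma cip_diff_left: "cip (x - y) z = cip x z - cip y z"
  by (simp add: cip_def sum_subtractf algebra_simps)

lemma cip_diff_right: "cip z (x - y) = cip z x - cip z y"
  by (simp add: cip_def sum_subtractf algebra_simps)

lemma cip_scale_left: "cip (c *s x) z = cnj c * cip x z"
  by (simp add: cip_def sum_distrib_left mult.assoc)

lemma cip_scale_right: "cip z (c *s x) = c * cip z x"
  by (simp add: cip_def sum_distrib_left mult_ac)

lemma cip_zero [simp]: "cip 0 x = 0" "cip x 0 = 0"
  by (simp_all add: cip_def)

lemma cnj_cip: "cnj (cip x y) = cip y x"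
  by (simp add: cip_def mult.commute)

lemma cip_uminus_right: "cip x (- y) = - cip x y"
  by (simp add: cip_def sum_negf)

lemma Re_cip_commute: "Re (cip x y) = Re (cip y x)"
  using arg_cong[OF cnj_cip[of x y], of Re] by simp

lemma Im_cip_commute: "Im (cip x y) = - Im (cip y x)"
  using arg_cong[OF cnj_cip[of y x], of Im] by simp

lemmas cip_simps = cip_add_left cip_add_right cip_diff_left cip_diff_right
  cip_scale_left cip_scale_right

lemma cip_self: "cip x x = complex_of_real ((norm x)\<^sup>2)"
proof -
  have "cip x x = (\<Sum>i\<in>UNIV. complex_of_real ((norm (x $ i))\<^sup>2))"
    unfolding cip_def by (intro sum.cong refl) (simp only: complex_norm_square mult.commute)
  also have "\<dots> = complex_of_real (\<Sum>i\<in>UNIV. (norm (x $ i))\<^sup>2)" by simp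
  also have "(\<Sum>i\<in>UNIV. (norm (x $ i))\<^sup>2) = (norm x)\<^sup>2"
    by (simp add: norm_vec_def L2_set_def sum_nonneg)
  finally show ?thesis .
qed

lemma cip_self_pos: "x \<noteq> 0 \<Longrightarrow> Re (cip x x) > 0"
  by (simp add: cip_self)

lemma cip_ctranspose: "cip x (ctranspose A *v x) = cnj (cip x (A *v x))"
proof -
  have "cip x (ctranspose A *v x) = (\<Sum>i\<in>UNIV. \<Sum>j\<in>UNIV. cnj (x $ i) * (cnj (A $ j $ i) * x $ j))"
    by (simp add: cip_def ctranspose_def transpose_def matrix_vector_mult_def sum_distrib_left)
  also have "\<dots> = (\<Sum>j\<in>UNIV. \<Sum>i\<in>UNIV. cnj (x $ i) * (cnj (A $ j $ i) * x $ j))"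
    by (rule sum.swap)
  also have "\<dots> = cnj (cip x (A *v x))"
    by (simp add: cip_def matrix_vector_mult_def sum_distrib_left mult_ac)
  finally show ?thesis .
qed

lemma mat_mult_vec: "mat c *v x = c *s (x :: 'a::comm_ring_1 ^ 'n)"
  by (simp add: vec_eq_iff mat_def matrix_vector_mult_def if_distrib[of "\<lambda>c. c * _"] cong: if_cong)

lemma uminus_matrix_vec: "(- A) *v x = - (A *v x)" for A :: "'a::comm_ring_1 ^ 'n ^ 'm"
  by (simp add: vec_eq_iff matrix_vector_mult_def sum_negf)

text \<open>Matrices whose quadratic form is real valued; over the complex numbers these are the Hermitian
  matrices, by polarization (\<open>real_form_adjoint\<close>).\<close>

definition real_form :: "complex ^ 'n ^ 'n \<Rightarrow> bool" where
  "real_form A \<longleftrightarrow> (\<forall>x. Im (cip x (A *v x)) = 0)"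

lemma real_form_adjoint:
  assumes "real_form A"
  shows "cip (A *v x) y = cip x (A *v y)"
proof -
  let ?h = "\<lambda>x y. cip x (A *v y)"
  have z: "Im (?h z z) = 0" for z using assms by (simp add: real_form_def)
  have "Im (?h (x + y) (x + y)) = 0" "Im (?h (x + \<i> *s y) (x + \<i> *s y)) = 0" using z by auto
  then have "Im (?h x y) + Im (?h y x) = 0" "Re (?h x y) - Re (?h y x) = 0"
    using z[of x] z[of y]
    by (simp_all add: matrix_vector_right_distrib vector_scalar_commute cip_simps)
  then have "?h x y = cnj (?h y x)" by (simp add: complex_eq_iff)
  then show ?thesis by (simp add: cnj_cip)
qed

lemma real_form_Re: "real_form A \<Longrightarrow> cip x (A *v x) = complex_of_real (Re (cip x (A *v x)))"
  by (simp add: real_form_def complex_eq_iff)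

text \<open>An isotropic vector of a positive semidefinite form lies in the kernel.\<close>

lemma semidefinite_kernel:
  assumes rf: "real_form B" and psd: "\<And>x. Re (cip x (B *v x)) \<ge> 0"
    and u: "Re (cip u (B *v u)) = 0"
  shows "B *v u = 0"
proof (rule ccontr)
  assume nz: "B *v u \<noteq> 0"
  define y where "y = B *v u"
  define a where "a = Re (cip y y)"
  define b where "b = Re (cip y (B *v y))"
  have "a > 0" unfolding a_def y_def by (rule cip_self_pos[OF nz])
  have "b \<ge> 0" unfolding b_def by (rule psd)
  have uy: "cip u (B *v y) = cip y y" using real_form_adjoint[OF rf, of u y] by (simp add: y_def)
  \<comment> \<open>Moving from \<open>u\<close> against its image would make the form negative to first order.\<close>
  have key: "- 2 * t * a + t\<^sup>2 * b \<ge> 0" for t :: real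
  proof -
    have "cip (u - of_real t *s y) (B *v (u - of_real t *s y)) =
      cip u (B *v u) - 2 * of_real t * cip y y + (of_real t)\<^sup>2 * cip y (B *v y)"
      unfolding matrix_vector_mult_diff_distrib vector_scalar_commute cip_simps uy
      by (simp flip: y_def add: algebra_simps power2_eq_square)
    then have "Re (cip (u - of_real t *s y) (B *v (u - of_real t *s y))) = - 2 * t * a + t\<^sup>2 * b"
      using u by (simp add: a_def b_def flip: of_real_power)
    then show ?thesis using psd by metis
  qed
  define t where "t = a / (b + 1)"
  have "t > 0" "t * b \<le> a" using \<open>a > 0\<close> \<open>b \<ge> 0\<close> by (simp_all add: t_def field_simps)
  then have "t * (t * b - 2 * a) < 0" using \<open>a > 0\<close> by (intro mult_pos_neg) auto
  then show False using key[of t] by (simp add: algebra_simps power2_eq_square)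
qed

lemma invertible_iff_kernel:
  fixes A :: "'a::field ^ 'n ^ 'n"
  shows "invertible A \<longleftrightarrow> (\<forall>x. A *v x = 0 \<longrightarrow> x = 0)"
  by (simp add: invertible_left_inverse matrix_left_invertible_ker)

lemma eigenvalue_of_iff_det: "eigenvalue_of A l \<longleftrightarrow> det (A - mat l) = 0"
proof -
  have "eigenvalue_of A l \<longleftrightarrow> \<not> (\<forall>x. (A - mat l) *v x = 0 \<longrightarrow> x = 0)"
    by (auto simp: eigenvalue_of_def matrix_vector_mult_diff_rdistrib mat_mult_vec)
  then show ?thesis
    using invertible_iff_kernel invertible_det_nz by metis
qed

text \<open>The characteristic polynomial has finitely many roots, unless it is zero; a single point
  that is not an eigenvalue excludes the latter.\<close>

lemma finite_real_eigenvalues: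
  fixes A :: "complex ^ 'n ^ 'n"
  assumes "\<not> eigenvalue_of A l0"
  shows "finite {x. eigenvalue_of A (complex_of_real x)}"
proof -
  define P :: "complex poly ^ 'n ^ 'n" where
    "P = (\<chi> i j. [:A $ i $ j, if i = j then - 1 else 0:])"
  have ev: "poly (det P) z = det (A - mat z)" for z
  proof -
    interpret partial_ring_hom UNIV "\<lambda>p :: complex poly. poly p z"
      by unfold_locales auto
    have "map_matrix (\<lambda>p. poly p z) P = A - mat z"
      by (simp add: P_def vec_eq_iff mat_def)
    then show ?thesis using det_mem_hom[of P] by simp
  qed
  have "det P \<noteq> 0"
    using assms ev[of l0] by (auto simp: eigenvalue_of_iff_det)
  then have "finite {z. poly (det P) z = 0}" by (rule poly_roots_finite)
  then have "finite (complex_of_real -` {z. poly (det P) z = 0})"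
    by (rule finite_vimageI) (simp add: inj_on_def)
  then show ?thesis by (simp add: eigenvalue_of_iff_det ev vimage_def)
qed

text \<open>The maximum \<open>\<mu>\<close> of the generalized Rayleigh quotient of \<open>N M N\<close> with respect to \<open>N\<close> over the
  unit sphere is an eigenvalue of \<open>M N\<close>: a maximizer is an isotropic vector of the semidefinite
  form \<open>\<mu> N - N M N\<close>.\<close>

lemma product_form_max:
  fixes M N :: "complex ^ 'n ^ 'n"
  assumes M: "real_form M" and N: "real_form N"
    and pos: "\<And>x. x \<noteq> 0 \<Longrightarrow> Re (cip x (N *v x)) > 0"
  obtains u and \<mu> :: real where "u \<noteq> 0" "M *v (N *v u) = complex_of_real \<mu> *s u"
    "\<forall>x. Re (cip (N *v x) (M *v (N *v x))) \<le> \<mu> * Re (cip x (N *v x))"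
proof -
  define f where "f x = Re (cip (N *v x) (M *v (N *v x)))" for x
  define g where "g x = Re (cip x (N *v x))" for x
  let ?S = "sphere (0 :: complex ^ 'n) 1"
  have cont: "continuous_on ?S (\<lambda>x. f x / g x)"
  proof -
    have "g x \<noteq> 0" if "x \<in> ?S" for x
    proof -
      have "x \<noteq> 0" using that by auto
      then show ?thesis using pos[of x] by (simp add: g_def)
    qed
    then show ?thesis
      unfolding f_def g_def cip_def matrix_vector_mul_assoc
      by (intro continuous_intros matrix_vector_mult_linear_continuous_on) auto
  qed
  have "?S \<noteq> {}" by simp
  then obtain u where u: "u \<in> ?S" "\<And>x. x \<in> ?S \<Longrightarrow> f x / g x \<le> f u / g u"
    using continuous_attains_sup[OF compact_sphere _ cont] by blast
  define \<mu> where "\<mu> = f u / g u"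
  have "u \<noteq> 0" using u(1) by auto
  have hom: "f (complex_of_real c *s x) = c\<^sup>2 * f x" "g (complex_of_real c *s x) = c\<^sup>2 * g x"
    for c x
    by (simp_all add: f_def g_def vector_scalar_commute cip_simps power2_eq_square)
  have le: "f x \<le> \<mu> * g x" for x
  proof (cases "x = 0")
    case True
    then show ?thesis by (simp add: f_def g_def)
  next
    case False
    define y where "y = complex_of_real (1 / norm x) *s x"
    have "y = (1 / norm x) *\<^sub>R x"
      by (simp add: y_def vec_eq_iff scaleR_conv_of_real[where 'a = complex])
    then have "y \<in> ?S" using False by simp
    then have "f y / g y \<le> \<mu>" using u(2) by (simp add: \<mu>_def)
    moreover have "f y / g y = f x / g x"
      using False unfolding y_def hom by simp
    ultimately show ?thesis using pos[OF False] by (simp add: g_def[symmetric] pos_divide_le_eq)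
  qed
  define B where "B = mat (complex_of_real \<mu>) ** N - N ** M ** N"
  have Bv: "B *v x = complex_of_real \<mu> *s (N *v x) - N *v (M *v (N *v x))" for x
    by (simp add: B_def matrix_vector_mult_diff_rdistrib mat_mult_vec
        flip: matrix_vector_mul_assoc)
  have Bq: "cip x (B *v x) = complex_of_real (\<mu> * g x - f x)" for x
  proof -
    have "cip x (N *v (M *v (N *v x))) = cip (N *v x) (M *v (N *v x))"
      by (simp add: real_form_adjoint[OF N])
    also have "\<dots> = complex_of_real (f x)"
      unfolding f_def by (rule real_form_Re[OF M])
    finally show ?thesis
      using real_form_Re[OF N, of x] by (simp add: Bv cip_simps g_def)
  qed
  have "B *v u = 0"
  proof (rule semidefinite_kernel)
    show "real_form B" by (simp add: real_form_def Bq)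
    show "Re (cip x (B *v x)) \<ge> 0" for x using le by (simp add: Bq)
    have "g u > 0" using pos[OF \<open>u \<noteq> 0\<close>] by (simp add: g_def)
    then show "Re (cip u (B *v u)) = 0" by (simp add: Bq \<mu>_def)
  qed
  then have "N *v (complex_of_real \<mu> *s u - M *v (N *v u)) = 0"
    by (simp add: Bv matrix_vector_mult_diff_distrib vector_scalar_commute)
  then have "complex_of_real \<mu> *s u - M *v (N *v u) = 0"
    using pos[of "complex_of_real \<mu> *s u - M *v (N *v u)"] by auto
  then show ?thesis
    using that[of u \<mu>] \<open>u \<noteq> 0\<close> le by (simp add: f_def g_def)
qed

lemma max_eigenvalue_product:
  fixes M N :: "complex ^ 'n ^ 'n"
  assumes M: "real_form M" and N: "real_form N"
    and pos: "\<And>x. x \<noteq> 0 \<Longrightarrow> Re (cip x (N *v x)) > 0"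
  defines "\<mu> \<equiv> max_eigenvalue (M ** N)"
  obtains u where "u \<noteq> 0" "M *v (N *v u) = complex_of_real \<mu> *s u"
    "\<forall>x. Re (cip (N *v x) (M *v (N *v x))) \<le> \<mu> * Re (cip x (N *v x))"
proof -
  obtain u m where mu: "u \<noteq> 0" "M *v (N *v u) = complex_of_real m *s u"
    "\<forall>x. Re (cip (N *v x) (M *v (N *v x))) \<le> m * Re (cip x (N *v x))"
    by (rule product_form_max[OF M N pos])
  let ?E = "{x. eigenvalue_of (M ** N) (complex_of_real x)}"
  have le: "l \<le> m" if ev: "eigenvalue_of (M ** N) (complex_of_real l)" for l
  proof -
    obtain v where "v \<noteq> 0" "(M ** N) *v v = complex_of_real l *s v"
      using ev unfolding eigenvalue_of_def by blast
    then have v: "v \<noteq> 0" "M *v (N *v v) = complex_of_real l *s v"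
      by (simp_all add: matrix_vector_mul_assoc)
    have "Re (cip (N *v v) (M *v (N *v v))) = l * Re (cip v (N *v v))"
      by (simp add: v cip_simps real_form_adjoint[OF N])
    then show ?thesis using mu(3)[THEN spec, of v] pos[OF v(1)] by simp
  qed
  have "\<not> eigenvalue_of (M ** N) (complex_of_real (m + 1))" using le[of "m + 1"] by auto
  then have "finite ?E" by (rule finite_real_eigenvalues)
  moreover have "m \<in> ?E"
    using mu(1,2) unfolding matrix_vector_mul_assoc eigenvalue_of_def by blast
  ultimately have "\<mu> = m"
    unfolding \<mu>_def max_eigenvalue_def using le by (intro Max_eqI) auto
  then show ?thesis using that mu by blast
qed

section \<open>Negative imaginary systems\<close>

text \<open>The quadratic form of the transfer matrix at the point \<open>s\<close>.\<close>

abbreviation qf :: "('n::finite) tfm \<Rightarrow> complex \<Rightarrow> complex ^ 'n \<Rightarrow> complex" where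
  "qf R s x \<equiv> cip x (tf_eval R s *v x)"

text \<open>The negative imaginary property and its strict version, expressed by the imaginary part of
  the quadratic form: the Hermitian matrix \<open>\<i> (A - A\<^sup>H)\<close> has the form \<open>- 2 Im (x\<^sup>H A x)\<close>.\<close>

definition neg_imag :: "('n::finite) tfm \<Rightarrow> bool" where
  "neg_imag R \<longleftrightarrow> R \<in> RH_inf \<and> (\<forall>w>0. \<forall>x. Im (qf R (\<i> * complex_of_real w) x) \<le> 0)"

definition strictly_neg_imag :: "('n::finite) tfm \<Rightarrow> bool" where
  "strictly_neg_imag R \<longleftrightarrow>
     R \<in> RH_inf \<and> (\<forall>w>0. \<forall>x. x \<noteq> 0 \<longrightarrow> Im (qf R (\<i> * complex_of_real w) x) < 0)"

lemma cip_NI_form: "Re (cip x (NI_form R w *v x)) = - 2 * Im (qf R (\<i> * complex_of_real w) x)"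
proof -
  define A where "A = tf_eval R (\<i> * complex_of_real w)"
  have "NI_form R w *v x = \<i> *s (A *v x - ctranspose A *v x)"
    by (simp add: NI_form_def Let_def A_def vec_eq_iff matrix_vector_mult_def sum_distrib_left
        sum_subtractf algebra_simps)
  then show ?thesis by (simp add: cip_simps cip_ctranspose A_def)
qed

lemma NI_class_imp_neg_imag:
  assumes "R \<in> NI_class"
  shows "neg_imag R"
proof -
  have "Re (cip x (NI_form R w *v x)) \<ge> 0" if "w > 0" for w x
    using assms that by (simp add: NI_class_def pos_semidef_def cip_def)
  then show ?thesis using assms by (simp add: neg_imag_def cip_NI_form NI_class_def)
qed

lemma strict_NI_class_imp:
  assumes "R \<in> strict_NI_class"
  shows "strictly_neg_imag R"
proof -
  have "Re (cip x (NI_form R w *v x)) > 0" if "w > 0" "x \<noteq> 0" for w x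
    using assms that by (simp add: strict_NI_class_def pos_def_def cip_def)
  then show ?thesis
    using assms by (simp add: strictly_neg_imag_def cip_NI_form strict_NI_class_def)
qed

lemma strictly_neg_imag_imp: "strictly_neg_imag R \<Longrightarrow> neg_imag R"
  unfolding strictly_neg_imag_def neg_imag_def
  by (metis cip_zero(1) less_imp_le order_refl zero_complex.simps(2))

lemma qf_expand: "qf R s x = (\<Sum>i\<in>UNIV. \<Sum>j\<in>UNIV. cnj (x $ i) * (rat_eval (R $ i $ j) s * x $ j))"
  by (simp add: cip_def matrix_vector_mult_def tf_eval_def sum_distrib_left)

lemma qf_continuous: "R \<in> RH_inf \<Longrightarrow> continuous_on {s. Re s \<ge> 0} (\<lambda>s. qf R s x)"
  unfolding qf_expand by (intro continuous_intros rat_eval_continuous RH_inf_entry)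

lemma qf_holomorphic: "R \<in> RH_inf \<Longrightarrow> (\<lambda>s. qf R s x) holomorphic_on {s. Re s > 0}"
  unfolding qf_expand by (intro holomorphic_intros rat_eval_holomorphic RH_inf_entry)

lemma qf_at_inf_expand:
  "R \<in> RH_inf \<Longrightarrow> cip x (tf_at_inf R *v x) =
    (\<Sum>i\<in>UNIV. \<Sum>j\<in>UNIV. cnj (x $ i) * (rat_at_inf (R $ i $ j) * x $ j))"
  by (simp add: cip_def matrix_vector_mult_def tf_at_inf_eq sum_distrib_left)

lemma qf_tendsto:
  "R \<in> RH_inf \<Longrightarrow> ((\<lambda>s. qf R s x) \<longlongrightarrow> cip x (tf_at_inf R *v x)) at_infinity"
  unfolding qf_expand qf_at_inf_expand
  by (intro tendsto_intros rat_at_inf_tendsto RH_inf_entry)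

text \<open>Entrywise conjugation. Transfer matrices have real coefficients, hence conjugating the point
  of evaluation amounts to conjugating the vector and the value of the form.\<close>

definition vcnj :: "complex ^ 'n \<Rightarrow> complex ^ 'n" where
  "vcnj x = (\<chi> i. cnj (x $ i))"

lemma vcnj_vcnj [simp]: "vcnj (vcnj x) = x"
  by (simp add: vcnj_def vec_eq_iff)

lemma vcnj_eq_0_iff [simp]: "vcnj x = 0 \<longleftrightarrow> x = 0"
  by (simp add: vcnj_def vec_eq_iff)

lemma qf_cnj: "qf R (cnj s) x = cnj (qf R s (vcnj x))"
  by (simp add: qf_expand rat_eval_cnj vcnj_def)

lemma qf_axis_minus:
  "Im (qf R (\<i> * complex_of_real (- w)) x) = - Im (qf R (\<i> * complex_of_real w) (vcnj x))"
  using qf_cnj[of x R "\<i> * complex_of_real w"] by simp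

lemma neg_imag_axis:
  assumes "neg_imag R" "w \<noteq> 0"
  shows "w * Im (qf R (\<i> * complex_of_real w) x) \<le> 0"
proof (cases "w > 0")
  case True
  then show ?thesis using assms by (simp add: neg_imag_def mult_nonneg_nonpos)
next
  case False
  then have "- w > 0" using assms by simp
  then have "Im (qf R (\<i> * complex_of_real (- w)) (vcnj x)) \<le> 0"
    using assms(1) unfolding neg_imag_def by blast
  then have "Im (qf R (\<i> * complex_of_real w) x) \<ge> 0"
    using qf_axis_minus[of x R "- w"] by simp
  then show ?thesis using False by (intro mult_nonpos_nonneg) auto
qed

lemma strictly_neg_imag_axis:
  assumes "strictly_neg_imag R" "w \<noteq> 0" "x \<noteq> 0"
  shows "w * Im (qf R (\<i> * complex_of_real w) x) < 0"
proof (cases "w > 0")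
  case True
  then show ?thesis using assms by (simp add: strictly_neg_imag_def mult_pos_neg)
next
  case False
  then have "- w > 0" using assms by simp
  then have "Im (qf R (\<i> * complex_of_real (- w)) (vcnj x)) < 0"
    using assms(1) \<open>x \<noteq> 0\<close> vcnj_eq_0_iff[of x] unfolding strictly_neg_imag_def by blast
  then have "Im (qf R (\<i> * complex_of_real w) x) > 0"
    using qf_axis_minus[of x R "- w"] by simp
  then show ?thesis using False assms by (intro mult_neg_pos) auto
qed

text \<open>At the origin and at infinity the imaginary part of the form is a limit of nonpositive
  numbers, and it changes sign when the vector is conjugated, so it vanishes.\<close>

lemma real_form_at_0:
  assumes "neg_imag R"
  shows "real_form (tf_eval R 0)"
proof -
  have R: "R \<in> RH_inf" using assms by (simp add: neg_imag_def)
  have path: "((\<lambda>w. \<i> * complex_of_real w) \<longlongrightarrow> 0) (at_right 0)"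
    by (rule tendsto_eq_intros refl | simp)+
  have le: "Im (qf R 0 x) \<le> 0" for x
  proof -
    have "((\<lambda>w. Im (qf R (\<i> * complex_of_real w) x)) \<longlongrightarrow> Im (qf R 0 x)) (at_right 0)"
      by (intro tendsto_Im continuous_on_tendsto_compose[OF qf_continuous[OF R] path]) auto
    moreover have "eventually (\<lambda>w. Im (qf R (\<i> * complex_of_real w) x) \<le> 0) (at_right 0)"
      using eventually_at_right_less[of "0::real"]
      by eventually_elim (use assms in \<open>simp add: neg_imag_def\<close>)
    ultimately show ?thesis by (intro tendsto_upperbound) auto
  qed
  have "Im (qf R 0 x) = 0" for x
    using le[of x] le[of "vcnj x"] qf_cnj[of x R 0] by simp
  then show ?thesis by (simp add: real_form_def)
qed

lemma real_form_at_inf: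
  assumes "neg_imag R"
  shows "real_form (tf_at_inf R)"
proof -
  have R: "R \<in> RH_inf" using assms by (simp add: neg_imag_def)
  let ?q = "\<lambda>x. cip x (tf_at_inf R *v x)"
  have path: "filterlim (\<lambda>w. \<i> * complex_of_real w) at_infinity at_top"
    by (intro tendsto_mult_filterlim_at_infinity[where c = \<i>] tendsto_const
        filterlim_of_real_at_infinity) auto
  have le: "Im (?q x) \<le> 0" for x
  proof -
    have "((\<lambda>w. Im (qf R (\<i> * complex_of_real w) x)) \<longlongrightarrow> Im (?q x)) at_top"
      by (intro tendsto_Im filterlim_compose[OF qf_tendsto[OF R] path])
    moreover have "eventually (\<lambda>w. Im (qf R (\<i> * complex_of_real w) x) \<le> 0) at_top"
      using eventually_gt_at_top[of "0::real"]
      by eventually_elim (use assms in \<open>simp add: neg_imag_def\<close>)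
    ultimately show ?thesis by (intro tendsto_upperbound) auto
  qed
  have "?q (vcnj x) = cnj (?q x)" for x
    using R by (simp add: qf_at_inf_expand vcnj_def rat_at_inf_real RH_inf_entry)
  then have "Im (?q x) = 0" for x
    using le[of x] le[of "vcnj x"] by simp
  then show ?thesis by (simp add: real_form_def)
qed

lemma RH_inf_quotient_zero:
  assumes "R \<in> RH_inf"
  obtains K where "K \<in> RH_inf" "\<And>s x. Re s \<ge> 0 \<Longrightarrow> s * qf K s x = qf R s x - qf R 0 x"
proof -
  have "\<exists>g. g \<in> stable_rats \<and> (\<forall>s. Re s \<ge> 0 \<longrightarrow> s * rat_eval g s = rat_eval r s - rat_eval r 0)"
    if "r \<in> stable_rats" for r
    using stable_rats_quotient_zero[OF that] by metis
  then obtain g where g: "\<And>r. r \<in> stable_rats \<Longrightarrow> g r \<in> stable_rats"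
    "\<And>r s. r \<in> stable_rats \<Longrightarrow> Re s \<ge> 0 \<Longrightarrow> s * rat_eval (g r) s = rat_eval r s - rat_eval r 0"
    by metis
  have 1: "map_matrix g R \<in> RH_inf" using assms g by (simp add: RH_inf_iff)
  have 2: "s * qf (map_matrix g R) s x = qf R s x - qf R 0 x" if "Re s \<ge> 0" for s x
  proof -
    have "s * (cnj (x $ i) * (rat_eval (g (R $ i $ j)) s * x $ j)) =
      cnj (x $ i) * (rat_eval (R $ i $ j) s * x $ j) - cnj (x $ i) * (rat_eval (R $ i $ j) 0 * x $ j)"
      for i j
    proof -
      have "s * (cnj (x $ i) * (rat_eval (g (R $ i $ j)) s * x $ j)) =
        cnj (x $ i) * ((s * rat_eval (g (R $ i $ j)) s) * x $ j)"
        by (simp add: mult_ac)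
      then show ?thesis using g(2)[OF RH_inf_entry[OF assms] that] by (simp add: algebra_simps)
    qed
    then show ?thesis
      unfolding qf_expand nth_map_matrix sum_distrib_left by (simp add: sum_subtractf)
  qed
  show ?thesis using that 1 2 by blast
qed

lemma RH_inf_quotient_inf:
  assumes "R \<in> RH_inf"
  obtains G where "G \<in> RH_inf"
    "\<And>s x. Re s \<ge> 0 \<Longrightarrow> qf G s x = s * (qf R s x - cip x (tf_at_inf R *v x))"
proof -
  have "\<exists>g. g \<in> stable_rats \<and> (\<forall>s. Re s \<ge> 0 \<longrightarrow> rat_eval g s = s * (rat_eval r s - rat_at_inf r))"
    if "r \<in> stable_rats" for r
    using stable_rats_quotient_inf[OF that] by metis
  then obtain g where g: "\<And>r. r \<in> stable_rats \<Longrightarrow> g r \<in> stable_rats"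
    "\<And>r s. r \<in> stable_rats \<Longrightarrow> Re s \<ge> 0 \<Longrightarrow> rat_eval (g r) s = s * (rat_eval r s - rat_at_inf r)"
    by metis
  have 1: "map_matrix g R \<in> RH_inf" using assms g by (simp add: RH_inf_iff)
  have 2: "qf (map_matrix g R) s x = s * (qf R s x - cip x (tf_at_inf R *v x))" if "Re s \<ge> 0" for s x
    unfolding qf_expand qf_at_inf_expand[OF assms] nth_map_matrix sum_distrib_left
      sum_subtractf[symmetric] right_diff_distrib
    by (intro sum.cong refl) (simp add: g(2)[OF RH_inf_entry[OF assms] that] algebra_simps)
  show ?thesis using that 1 2 by blast
qed

lemma Re_div_axis: "w \<noteq> 0 \<Longrightarrow> Re (z / (\<i> * complex_of_real w)) = Im z / w"
  by (simp add: Re_divide power2_eq_square)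

text \<open>Positive realness of \<open>(R(0) - R(s)) / s\<close> and of \<open>s (R(s) - R(\<infinity>))\<close>. On the imaginary axis the
  real parts of their forms are multiples of the imaginary part of the form of \<open>R\<close>, because the
  forms of \<open>R(0)\<close> and \<open>R(\<infinity>)\<close> are real.\<close>

lemma neg_imag_difference:
  assumes "neg_imag R" "Re s > 0"
  shows "Re ((qf R 0 x - qf R s x) / s) \<ge> 0"
    and "strictly_neg_imag R \<Longrightarrow> x \<noteq> 0 \<Longrightarrow> Re ((qf R 0 x - qf R s x) / s) > 0"
proof -
  have R: "R \<in> RH_inf" using assms by (simp add: neg_imag_def)
  obtain K where K: "K \<in> RH_inf" "\<And>s x. Re s \<ge> 0 \<Longrightarrow> s * qf K s x = qf R s x - qf R 0 x"
    using RH_inf_quotient_zero[OF R] by blast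
  have eq: "- qf K z x = (qf R 0 x - qf R z x) / z" if "Re z \<ge> 0" "z \<noteq> 0" for z
    using K(2)[OF that(1), of x] that(2) by (simp add: field_simps)
  have axis: "Re (- qf K (\<i> * complex_of_real w) x) = - Im (qf R (\<i> * complex_of_real w) x) / w"
    if "w \<noteq> 0" for w
    using real_form_at_0[OF assms(1)] that
    by (subst eq) (simp_all add: Re_div_axis real_form_def del: minus_mult_right)
  have cont: "continuous_on {s. Re s \<ge> 0} (\<lambda>s. - qf K s x)"
    by (intro continuous_intros qf_continuous K)
  have holo: "(\<lambda>s. - qf K s x) holomorphic_on {s. Re s > 0}"
    by (intro holomorphic_intros qf_holomorphic K)
  note lim = tendsto_minus[OF qf_tendsto[OF K(1), of x]]
  have "s \<noteq> 0" "Re s \<ge> 0" using assms(2) by auto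
  have "Re (- qf K s x) \<ge> 0"
  proof (rule half_plane_Re_nonneg[OF cont holo lim _ \<open>Re s \<ge> 0\<close>])
    fix w :: real assume "w \<noteq> 0"
    then show "0 \<le> Re (- qf K (\<i> * complex_of_real w) x)"
      using neg_imag_axis[OF assms(1), of w x]
      by (subst axis) (auto simp: divide_le_0_iff mult_le_0_iff)
  qed
  then show "Re ((qf R 0 x - qf R s x) / s) \<ge> 0"
    using eq[OF \<open>Re s \<ge> 0\<close> \<open>s \<noteq> 0\<close>] by simp
  assume "strictly_neg_imag R" "x \<noteq> 0"
  have "Re (- qf K s x) > 0"
  proof (rule half_plane_Re_pos[OF cont holo lim _ assms(2)])
    fix w :: real assume "w \<noteq> 0"
    then show "0 < Re (- qf K (\<i> * complex_of_real w) x)"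
      using strictly_neg_imag_axis[OF \<open>strictly_neg_imag R\<close>, of w x] \<open>x \<noteq> 0\<close>
      by (subst axis) (auto simp: divide_less_0_iff mult_less_0_iff)
  qed
  then show "Re ((qf R 0 x - qf R s x) / s) > 0"
    using eq[OF \<open>Re s \<ge> 0\<close> \<open>s \<noteq> 0\<close>] by simp
qed

lemma neg_imag_inf_difference:
  assumes "neg_imag R" "Re s > 0"
  shows "Re (s * (qf R s x - cip x (tf_at_inf R *v x))) \<ge> 0"
proof -
  have R: "R \<in> RH_inf" using assms by (simp add: neg_imag_def)
  obtain G where G: "G \<in> RH_inf"
    "\<And>s x. Re s \<ge> 0 \<Longrightarrow> qf G s x = s * (qf R s x - cip x (tf_at_inf R *v x))"
    using RH_inf_quotient_inf[OF R] by blast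
  have "Re (qf G s x) \<ge> 0"
  proof (rule half_plane_Re_nonneg[OF qf_continuous[OF G(1)] qf_holomorphic[OF G(1)] qf_tendsto[OF G(1)]])
    fix w :: real assume "w \<noteq> 0"
    have "Im (cip x (tf_at_inf R *v x)) = 0"
      using real_form_at_inf[OF assms(1)] by (simp add: real_form_def)
    then have "Re (qf G (\<i> * complex_of_real w) x) = - (w * Im (qf R (\<i> * complex_of_real w) x))"
      by (subst G(2)) simp_all
    then show "0 \<le> Re (qf G (\<i> * complex_of_real w) x)"
      using neg_imag_axis[OF assms(1) \<open>w \<noteq> 0\<close>, of x] by simp
  qed (use assms in simp)
  then show ?thesis using G(2)[of s x] assms by simp
qed

lemma neg_imag_inf_le_zero:
  assumes "neg_imag R"
  shows "Re (cip x (tf_at_inf R *v x)) \<le> Re (qf R 0 x)"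
    and "strictly_neg_imag R \<Longrightarrow> x \<noteq> 0 \<Longrightarrow> Re (cip x (tf_at_inf R *v x)) < Re (qf R 0 x)"
  using neg_imag_difference[OF assms, of 1 x] neg_imag_inf_difference[OF assms, of 1 x] by auto

section \<open>Stability of the interconnection\<close>

lemma Re_of_real_mult: "Re (complex_of_real r * z) = r * Re z"
  by simp

lemma le_of_affine_le:
  fixes a b c d :: real
  assumes "\<And>e. e > 0 \<Longrightarrow> c + e * d \<le> a + e * b"
  shows "c \<le> a"
proof -
  have lim: "((\<lambda>e. c + e * d) \<longlongrightarrow> c) (at_right 0)" "((\<lambda>e. a + e * b) \<longlongrightarrow> a) (at_right 0)"
    by (rule tendsto_eq_intros refl | simp)+
  have "eventually (\<lambda>e. c + e * d \<le> a + e * b) (at_right 0)"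
    using eventually_at_right_less[of "0::real"] by eventually_elim (rule assms)
  then show ?thesis
    by (rule tendsto_le[OF trivial_limit_at_right_real lim(2) lim(1)])
qed

text \<open>\<open>N(s)\<close> is invertible in the closed right half plane, but its inverse grows at infinity
  whenever \<open>N(\<infinity>)\<close> is singular. Adding \<open>e > 0\<close> makes the inverse \<open>Q\<close> proper.\<close>

lemma regularized_inverse:
  fixes N :: "('n::finite) tfm"
  assumes N: "strictly_neg_imag N" and psd: "\<And>x. Re (cip x (tf_at_inf N *v x)) \<ge> 0" and e: "e > 0"
  obtains Q where "Q \<in> RH_inf"
    "\<And>s x. Re s \<ge> 0 \<Longrightarrow> tf_eval Q s *v (tf_eval N s *v x + complex_of_real e *s x) = x"
    "\<And>s x. Re s \<ge> 0 \<Longrightarrow> tf_eval N s *v (tf_eval Q s *v x) + complex_of_real e *s (tf_eval Q s *v x) = x"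
proof -
  have NI: "neg_imag N" by (rule strictly_neg_imag_imp[OF N])
  have NR: "N \<in> RH_inf" using N by (simp add: strictly_neg_imag_def)
  define E where "E = (mat (Fract [:e:] 1) :: 'n tfm)"
  have ER: "E \<in> RH_inf" unfolding E_def by (rule RH_inf_scalar)
  have EV: "tf_eval (N + E) s *v x = tf_eval N s *v x + complex_of_real e *s x" if "Re s \<ge> 0" for s x
    using RH_inf_add(2)[OF NR ER that] RH_inf_scalar(2)[OF that, of e, where 'n = 'n]
    by (simp add: E_def matrix_vector_mult_add_rdistrib mat_mult_vec)
  have EI: "tf_at_inf (N + E) *v x = tf_at_inf N *v x + complex_of_real e *s x" for x
    using RH_inf_add(3)[OF NR ER] RH_inf_scalar(3)[of e, where 'n = 'n]
    by (simp add: E_def matrix_vector_mult_add_rdistrib mat_mult_vec)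
  obtain Q where Q: "Q \<in> RH_inf" "(N + E) ** Q = mat 1" "Q ** (N + E) = mat 1"
  proof (rule RH_inf_inverse[of "N + E"])
    show "N + E \<in> RH_inf" by (rule RH_inf_add[OF NR ER])
    show "invertible (tf_at_inf (N + E))"
      unfolding invertible_iff_kernel
    proof (intro allI impI)
      fix x assume "tf_at_inf (N + E) *v x = 0"
      then have "cip x (tf_at_inf N *v x + complex_of_real e *s x) = 0" by (simp add: EI)
      then have "Re (cip x (tf_at_inf N *v x)) + e * Re (cip x x) = 0" by (simp add: cip_simps cip_self complex_eq_iff)
      then show "x = 0" using psd[of x] e cip_self_pos[of x]
        by (metis add_nonneg_pos less_irrefl mult_pos_pos)
    qed
    show "invertible (tf_eval (N + E) s)" if s: "Re s \<ge> 0" for s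
      unfolding invertible_iff_kernel
    proof (intro allI impI)
      fix x assume "tf_eval (N + E) s *v x = 0"
      then have "cip x (tf_eval N s *v x + complex_of_real e *s x) = 0" by (simp add: EV s)
      then have q: "qf N s x = complex_of_real (- (e * Re (cip x x)))"
        by (simp add: cip_simps cip_self complex_eq_iff)
      show "x = 0"
      proof (rule ccontr)
        assume "x \<noteq> 0"
        then have neg: "- (e * Re (cip x x)) < 0" using e cip_self_pos[of x] by simp
        consider "Re s > 0" | "s = 0" | w where "w \<noteq> 0" "s = \<i> * complex_of_real w"
          using s by (cases "Re s > 0"; cases "Im s = 0") (auto simp: complex_eq_iff)
        then show False
        proof cases
          case 1
          have "Im (cip x (tf_at_inf N *v x)) = 0"
            using real_form_at_inf[OF NI] by (simp add: real_form_def)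
          then have "Re s * (- (e * Re (cip x x)) - Re (cip x (tf_at_inf N *v x))) \<ge> 0"
            using neg_imag_inf_difference[OF NI 1, of x] by (simp add: q)
          then show False using neg psd[of x] 1 by (simp add: zero_le_mult_iff)
        next
          case 2
          then show False
            using neg_imag_inf_le_zero(1)[OF NI, of x] psd[of x] neg q by simp
        next
          case 3
          then show False
            using strictly_neg_imag_axis[OF N \<open>w \<noteq> 0\<close> \<open>x \<noteq> 0\<close>] q by simp
        qed
      qed
    qed
  qed
  have "tf_eval Q s ** tf_eval (N + E) s = mat 1" "tf_eval (N + E) s ** tf_eval Q s = mat 1"
    if "Re s \<ge> 0" for s
    using that RH_inf_mult(2)[OF Q(1) RH_inf_add(1)[OF NR ER] that]
      RH_inf_mult(2)[OF RH_inf_add(1)[OF NR ER] Q(1) that] RH_inf_one(2)[OF that, where 'n = 'n]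
    by (simp_all add: Q)
  then have "tf_eval Q s *v (tf_eval (N + E) s *v x) = x" "tf_eval (N + E) s *v (tf_eval Q s *v x) = x"
    if "Re s \<ge> 0" for s x
    using that by (simp_all add: matrix_vector_mul_assoc)
  then show ?thesis using that[OF Q(1)] by (simp add: EV)
qed

text \<open>Positive realness of \<open>(N(s)\<^sup>-\<^sup>1 - N(0)\<^sup>-\<^sup>1) / s\<close>, stated for the vector \<open>v = N(s) u = N(0) y\<close> so
  that no inverse occurs. The inverse \<open>Q\<close> of \<open>N + e\<close> is proper and \<open>- Q\<close> is negative imaginary, so
  \<open>(Q(s) - Q(0)) / s\<close> is positive real; then \<open>e\<close> tends to 0.\<close>

lemma strictly_neg_imag_inverse:
  fixes N :: "('n::finite) tfm"
  assumes N: "strictly_neg_imag N" and psd: "\<And>x. Re (cip x (tf_at_inf N *v x)) \<ge> 0"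
    and s: "Re s > 0" and v: "tf_eval N s *v u = tf_eval N 0 *v y"
  shows "Re (qf N 0 y) * Re (1 / s) \<le> Re (cip (tf_eval N s *v u) u / s)"
proof -
  have NI: "neg_imag N" by (rule strictly_neg_imag_imp[OF N])
  define v where "v = tf_eval N s *v u"
  have vy: "v = tf_eval N 0 *v y" using v by (simp add: v_def)
  have s1: "Re (1 / s) > 0" using s by (simp add: Re_divide sum_power2_gt_zero_iff)
  have "Re (qf N 0 y) * Re (1 / s) + e * (Re (1 / s) * (2 * Re (cip y u) - Re (cip y y)))
      \<le> Re (cip v u / s) + e * Re (cip u u / s)" if e: "e > 0" for e
  proof -
    obtain Q where Q: "Q \<in> RH_inf"
      "\<And>s x. Re s \<ge> 0 \<Longrightarrow> tf_eval Q s *v (tf_eval N s *v x + complex_of_real e *s x) = x"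
      "\<And>s x. Re s \<ge> 0 \<Longrightarrow> tf_eval N s *v (tf_eval Q s *v x) + complex_of_real e *s (tf_eval Q s *v x) = x"
      using regularized_inverse[OF N psd e] by blast
    have Qn: "cip x (tf_eval Q s *v x) = cnj (qf N s (tf_eval Q s *v x)) +
        e * cip (tf_eval Q s *v x) (tf_eval Q s *v x)" if "Re s \<ge> 0" for s x
      by (subst (1) Q(3)[OF that, of x, symmetric]) (simp add: cip_simps cnj_cip)
    have mQ: "neg_imag (- Q)"
      unfolding neg_imag_def
    proof (intro conjI allI impI)
      show "- Q \<in> RH_inf" by (rule RH_inf_uminus[OF Q(1)])
      fix w :: real and x assume "w > 0"
      then show "Im (qf (- Q) (\<i> * complex_of_real w) x) \<le> 0"
        using NI Qn[of "\<i> * complex_of_real w" x]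
        by (simp add: RH_inf_uminus[OF Q(1)] uminus_matrix_vec cip_uminus_right neg_imag_def cip_self)
    qed
    define x where "x = v + complex_of_real e *s u"
    have Qs: "tf_eval Q s *v x = u" using Q(2)[of s u] s by (simp add: x_def v_def)
    define z where "z = tf_eval Q 0 *v x"
    have z: "tf_eval N 0 *v z + complex_of_real e *s z = x" using Q(3)[of 0 x] by (simp add: z_def)
    have rN: "cip a (tf_eval N 0 *v b) = cip (tf_eval N 0 *v a) b" for a b
      using real_form_adjoint[OF real_form_at_0[OF NI], of a b] by simp
    have im0: "Im (qf N 0 a) = 0" for a
      using real_form_at_0[OF NI] by (simp add: real_form_def)
    have imz: "Im (cip x z) = 0"
      using Qn[of 0 x] im0[of z] by (simp add: z_def cip_self)
    \<comment> \<open>Completing the square bounds the form of \<open>Q(0)\<close> at \<open>x\<close> from below by an expression that is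
        affine in \<open>e\<close>, so that the limit needs no continuity of the inverse.\<close>
    have "0 \<le> Re (qf N 0 (z - y)) + e * Re (cip (z - y) (z - y))"
      using neg_imag_inf_le_zero(1)[OF NI, of "z - y"] psd[of "z - y"] e
      by (simp add: cip_self)
    also have "\<dots> = Re (cip (tf_eval N 0 *v (z - y) + complex_of_real e *s (z - y)) (z - y))"
      by (simp add: rN cip_simps algebra_simps)
    also have "tf_eval N 0 *v (z - y) + complex_of_real e *s (z - y) = x - (v + complex_of_real e *s y)"
      by (simp add: vy flip: z) (simp add: matrix_vector_mult_diff_distrib vector_ssub_ldistrib)
    also have "Re (cip (x - (v + complex_of_real e *s y)) (z - y)) =
      Re (cip x z) - 2 * Re (cip y x) + Re (cip y v) + e * Re (cip y y)"
    proof -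
      have "cip (v + complex_of_real e *s y) z = cip y x"
        by (simp add: vy cip_simps rN flip: z)
      moreover have "Re (cip x y) = Re (cip y x)" "Re (cip v y) = Re (cip y v)"
        by (rule Re_cip_commute)+
      ultimately show ?thesis by (simp add: cip_simps)
    qed
    finally have "2 * Re (cip y x) - Re (cip y v) - e * Re (cip y y) \<le> Re (cip x z)" by simp
    moreover have "Re (cip y x) = Re (cip y v) + e * Re (cip y u)"
      by (simp add: x_def cip_simps)
    ultimately have low: "Re (cip y v) + e * (2 * Re (cip y u) - Re (cip y y)) \<le> Re (cip x z)"
      by (simp add: algebra_simps)
    have "0 \<le> Re ((qf (- Q) 0 x - qf (- Q) s x) / s)"
      by (rule neg_imag_difference(1)[OF mQ s])
    also have "\<dots> = Re (cip x u / s) - Re (cip x z / s)"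
      using s by (simp add: RH_inf_uminus[OF Q(1)] uminus_matrix_vec cip_uminus_right Qs z_def
          diff_divide_distrib)
    also have "cip x z / s = of_real (Re (cip x z)) * (1 / s)"
      using imz by (simp add: complex_eq_iff[of "cip x z"])
    finally have "Re (cip x z) * Re (1 / s) \<le> Re (cip x u / s)"
      unfolding Re_of_real_mult by linarith
    moreover have "(Re (cip y v) + e * (2 * Re (cip y u) - Re (cip y y))) * Re (1 / s) \<le> Re (cip x z) * Re (1 / s)"
      using low s1 by (intro mult_right_mono) auto
    moreover have "cip x u / s = cip v u / s + of_real e * (cip u u / s)"
      by (simp add: x_def cip_simps add_divide_distrib)
    then have "Re (cip x u / s) = Re (cip v u / s) + e * Re (cip u u / s)"
      by (simp only: plus_complex.sel Re_of_real_mult)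
    ultimately show ?thesis by (simp add: vy algebra_simps)
  qed
  from le_of_affine_le[OF this] show ?thesis by (simp add: v_def)
qed

lemma strictly_neg_imag_pos_at_0:
  assumes "strictly_neg_imag N" "\<And>x. Re (cip x (tf_at_inf N *v x)) \<ge> 0" "x \<noteq> 0"
  shows "Re (qf N 0 x) > 0"
  using neg_imag_inf_le_zero(2)[OF strictly_neg_imag_imp[OF assms(1)] assms(1,3)] assms(2)[of x]
  by linarith

lemma loop_no_boundary_zero:
  assumes M: "neg_imag M" and N: "strictly_neg_imag N" and w: "w \<noteq> 0"
    and loop: "tf_eval N (\<i> * complex_of_real w) *v (tf_eval M (\<i> * complex_of_real w) *v v) = v"
  shows "v = 0"
proof (rule ccontr)
  assume "v \<noteq> 0"
  define s where "s = \<i> * complex_of_real w"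
  define u where "u = tf_eval M s *v v"
  have v: "tf_eval N s *v u = v" using loop by (simp add: u_def s_def)
  then have "u \<noteq> 0" using \<open>v \<noteq> 0\<close> by auto
  have "w * Im (cip u v) < 0"
    using strictly_neg_imag_axis[OF N w \<open>u \<noteq> 0\<close>] by (simp add: v flip: s_def)
  moreover have "w * Im (cip v u) \<le> 0"
    using neg_imag_axis[OF M w, of v] by (simp flip: s_def u_def)
  moreover have "Im (cip u v) = - Im (cip v u)" by (rule Im_cip_commute)
  ultimately show False by simp
qed

text \<open>For \<open>v = N(s) M(s) v\<close> the forms of \<open>N(s)\<^sup>-\<^sup>1\<close> and \<open>M(s)\<close> agree at \<open>v\<close>. Both are compared with
  their values at the origin, the first from below and the second from above, contradicting
  \<open>M(0) < N(0)\<^sup>-\<^sup>1\<close>, which is the hypothesis \<open>dc\<close> in the variable \<open>x = N(0)\<^sup>-\<^sup>1 v\<close>.\<close>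

lemma loop_no_interior_zero:
  fixes M N :: "('n::finite) tfm"
  assumes M: "neg_imag M" and N: "strictly_neg_imag N"
    and psd: "\<And>x. Re (cip x (tf_at_inf N *v x)) \<ge> 0"
    and dc: "\<And>x. x \<noteq> 0 \<Longrightarrow> Re (qf M 0 (tf_eval N 0 *v x)) < Re (qf N 0 x)"
    and s: "Re s > 0" and loop: "tf_eval N s *v (tf_eval M s *v v) = v"
  shows "v = 0"
proof (rule ccontr)
  assume "v \<noteq> 0"
  define u where "u = tf_eval M s *v v"
  have v: "tf_eval N s *v u = v" using loop by (simp add: u_def)
  have "invertible (tf_eval N 0)"
    unfolding invertible_iff_kernel
    using strictly_neg_imag_pos_at_0[OF N psd] by (metis cip_zero(2) less_irrefl zero_complex.simps(1))
  then obtain B where "tf_eval N 0 ** B = mat 1" by (auto simp: invertible_def)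
  then have y: "tf_eval N 0 *v (B *v v) = v" by (simp add: matrix_vector_mul_assoc)
  define y where "y = B *v v"
  have "y \<noteq> 0" using y \<open>v \<noteq> 0\<close> by (auto simp: y_def)
  have "Re (qf N 0 y) * Re (1 / s) \<le> Re (cip v u / s)"
    using strictly_neg_imag_inverse[OF N psd s, of u y] y by (simp add: v y_def)
  also have "\<dots> \<le> Re (qf M 0 v / s)"
    using neg_imag_difference(1)[OF M s, of v] by (simp add: u_def diff_divide_distrib)
  also have "qf M 0 v / s = of_real (Re (qf M 0 v)) * (1 / s)"
    using real_form_Re[OF real_form_at_0[OF M], of v] by simp
  also have "Re (of_real (Re (qf M 0 v)) * (1 / s)) = Re (qf M 0 v) * Re (1 / s)"
    by (rule Re_of_real_mult)
  finally have "Re (qf N 0 y) * Re (1 / s) \<le> Re (qf M 0 v) * Re (1 / s)" .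
  moreover have "Re (1 / s) > 0" using s by (simp add: Re_divide sum_power2_gt_zero_iff)
  ultimately have "Re (qf N 0 y) \<le> Re (qf M 0 v)" by simp
  then show False using dc[OF \<open>y \<noteq> 0\<close>] y by (simp add: y_def)
qed

lemma closed_loop_maps_of_inverse:
  fixes M N W :: "('n::finite) tfm"
  assumes W: "W ** (mat 1 - N ** M) = mat 1" "(mat 1 - N ** M) ** W = mat 1"
  shows "closed_loop_maps M N W (W ** N) (M ** W) (mat 1 + M ** (W ** N))"
  unfolding closed_loop_maps_def
proof (intro allI)
  fix w1 w2 e1 e2 :: "real poly fract ^ 'n"
  define r where "r = w1 + N *v w2"
  have 1: "e1 = w1 + N *v (w2 + M *v e1) \<longleftrightarrow> (mat 1 - N ** M) *v e1 = r"
    by (auto simp: r_def matrix_vector_mult_diff_rdistrib matrix_vector_right_distrib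
        matrix_vector_mul_assoc algebra_simps)
  have 2: "(mat 1 - N ** M) *v e1 = r \<longleftrightarrow> e1 = W *v r"
    using W by (metis matrix_vector_mul_assoc matrix_vector_mul_lid)
  have 3: "W *v w1 + (W ** N) *v w2 = W *v r"
    "(M ** W) *v w1 + (mat 1 + M ** (W ** N)) *v w2 = w2 + M *v (W *v r)"
    by (simp_all add: r_def matrix_vector_right_distrib matrix_vector_mult_add_rdistrib
        matrix_vector_mul_assoc matrix_mul_assoc add_ac)
  show "e1 = w1 + N *v e2 \<and> e2 = w2 + M *v e1 \<longleftrightarrow>
      e1 = W *v w1 + (W ** N) *v w2 \<and> e2 = (M ** W) *v w1 + (mat 1 + M ** (W ** N)) *v w2"
    unfolding 3 using 1 2 by metis
qed

text \<open>Only the response to \<open>w2\<close> is needed: \<open>H12\<close> is the map \<open>N (1 - M N)\<^sup>-\<^sup>1\<close>.\<close>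

lemma closed_loop_maps_equations:
  fixes M N :: "('n::finite) tfm"
  assumes "closed_loop_maps M N H11 H12 H21 H22"
  shows "H12 = N ** H22" "H22 = mat 1 + M ** H12"
proof -
  have key: "e1 = w1 + N *v e2 \<and> e2 = w2 + M *v e1"
    if "e1 = H11 *v w1 + H12 *v w2" "e2 = H21 *v w1 + H22 *v w2" for e1 e2 w1 w2
    using assms that unfolding closed_loop_maps_def by blast
  have "H12 *v w = 0 + N *v (H22 *v w) \<and> H22 *v w = w + M *v (H12 *v w)" for w
    by (rule key) simp_all
  note eqs = this[unfolded add_0]
  from eqs show "H12 = N ** H22" "H22 = mat 1 + M ** H12"
    unfolding matrix_eq matrix_vector_mul_assoc[symmetric] matrix_vector_mult_add_rdistrib
      matrix_vector_mul_lid by blast+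
qed

lemma stable_of_dc_gain:
  fixes M N :: "('n::finite) tfm"
  assumes M: "neg_imag M" and N: "strictly_neg_imag N"
    and psd: "\<And>x. Re (cip x (tf_at_inf N *v x)) \<ge> 0"
    and MN: "tf_at_inf M ** tf_at_inf N = 0"
    and dc: "\<And>x. x \<noteq> 0 \<Longrightarrow> Re (qf M 0 (tf_eval N 0 *v x)) < Re (qf N 0 x)"
  shows "internally_stable M N"
proof -
  have R: "M \<in> RH_inf" "N \<in> RH_inf" using M N by (auto simp: neg_imag_def strictly_neg_imag_def)
  note NM = RH_inf_mult[OF R(2) R(1)]
  note I = RH_inf_one[where 'n = 'n]
  obtain W where W: "W \<in> RH_inf" "(mat 1 - N ** M) ** W = mat 1" "W ** (mat 1 - N ** M) = mat 1"
  proof (rule RH_inf_inverse[OF RH_inf_diff(1)[OF I(1) NM(1)]])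
    show "invertible (tf_at_inf (mat 1 - N ** M))"
      unfolding invertible_iff_kernel RH_inf_diff(3)[OF I(1) NM(1)] I(3) NM(3)
    proof (intro allI impI)
      fix v assume "(mat 1 - tf_at_inf N ** tf_at_inf M) *v v = 0"
      then have v: "v = tf_at_inf N *v (tf_at_inf M *v v)"
        by (simp add: matrix_vector_mult_diff_rdistrib matrix_vector_mul_assoc)
      have "tf_at_inf M *v v = (tf_at_inf M ** tf_at_inf N) *v (tf_at_inf M *v v)"
        by (subst v) (simp add: matrix_vector_mul_assoc matrix_mul_assoc)
      then show "v = 0" using v by (simp add: MN)
    qed
    show "invertible (tf_eval (mat 1 - N ** M) s)" if s: "Re s \<ge> 0" for s
      unfolding invertible_iff_kernel RH_inf_diff(2)[OF I(1) NM(1) s] I(2)[OF s] NM(2)[OF s]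
    proof (intro allI impI)
      fix v assume "(mat 1 - tf_eval N s ** tf_eval M s) *v v = 0"
      then have v: "tf_eval N s *v (tf_eval M s *v v) = v"
        by (simp add: matrix_vector_mult_diff_rdistrib matrix_vector_mul_assoc)
      consider "Re s > 0" | "s = 0" | w where "w \<noteq> 0" "s = \<i> * complex_of_real w"
        using s by (cases "Re s > 0"; cases "Im s = 0") (auto simp: complex_eq_iff)
      then show "v = 0"
      proof cases
        case 1
        then show ?thesis using loop_no_interior_zero[OF M N psd dc 1 v] by blast
      next
        case 2
        define u where "u = tf_eval M 0 *v v"
        have Nu: "tf_eval N 0 *v u = v" using v 2 by (simp add: u_def)
        have "Re (qf M 0 (tf_eval N 0 *v u)) = Re (qf N 0 u)"
          by (simp add: Nu flip: u_def) (rule Re_cip_commute)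
        then have "u = 0" using dc[of u] by force
        then show ?thesis using Nu by simp
      next
        case 3
        then show ?thesis using loop_no_boundary_zero[OF M N 3(1)] v by simp
      qed
    qed
  qed
  note WN = RH_inf_mult(1)[OF W(1) R(2)]
  have "mat 1 + M ** (W ** N) \<in> RH_inf" "M ** W \<in> RH_inf"
    by (intro RH_inf_add(1) RH_inf_mult(1) I(1) R W(1))+
  moreover have "invertible (mat 1 - tf_at_inf M ** tf_at_inf N)"
    by (simp add: MN invertible_det_nz)
  ultimately show ?thesis
    unfolding internally_stable_def
    using closed_loop_maps_of_inverse[OF W(3) W(2)] W(1) WN by blast
qed

text \<open>The closed loop map \<open>T\<close> from \<open>w2\<close> to \<open>e1\<close> inherits the negative imaginary property, and
  \<open>T(\<infinity>) = N(\<infinity>)\<close> because \<open>M(\<infinity>) N(\<infinity>) = 0\<close>. Hence \<open>T(0)\<close> is at least \<open>N(\<infinity>)\<close>, thus positive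
  semidefinite. At an eigenvector \<open>u\<close> of \<open>M(0) N(0)\<close> for \<open>\<mu>\<close> the form of \<open>T(0)\<close> is that of \<open>N(0)\<close>
  divided by \<open>1 - \<mu>\<close>.\<close>

lemma dc_gain_of_stable:
  fixes M N :: "('n::finite) tfm"
  assumes M: "neg_imag M" and N: "strictly_neg_imag N"
    and psd: "\<And>x. Re (cip x (tf_at_inf N *v x)) \<ge> 0"
    and MN: "tf_at_inf M ** tf_at_inf N = 0"
    and stable: "internally_stable M N"
    and u: "u \<noteq> 0" "tf_eval M 0 *v (tf_eval N 0 *v u) = complex_of_real \<mu> *s u"
  shows "\<mu> < 1"
proof -
  have R: "M \<in> RH_inf" "N \<in> RH_inf" using M N by (auto simp: neg_imag_def strictly_neg_imag_def)
  obtain H11 T H21 H where cl: "closed_loop_maps M N H11 T H21 H"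
    and T: "T \<in> RH_inf" and H: "H \<in> RH_inf"
    using stable unfolding internally_stable_def by blast
  note eqs = closed_loop_maps_equations[OF cl]
  note MT = RH_inf_mult[OF R(1) T]
  note I = RH_inf_one[where 'n = 'n]
  have Ts: "tf_eval T s = tf_eval N s ** tf_eval H s"
    and Hs: "tf_eval H s = mat 1 + tf_eval M s ** tf_eval T s" if "Re s \<ge> 0" for s
  proof -
    show "tf_eval T s = tf_eval N s ** tf_eval H s"
      by (subst eqs(1)) (rule RH_inf_mult(2)[OF R(2) H that])
    show "tf_eval H s = mat 1 + tf_eval M s ** tf_eval T s"
      by (subst eqs(2)) (simp only: RH_inf_add(2)[OF I(1) MT(1) that] I(2)[OF that] MT(2)[OF that])
  qed
  have Ti: "tf_at_inf T = tf_at_inf N ** tf_at_inf H"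
    by (subst eqs(1)) (rule RH_inf_mult(3)[OF R(2) H])
  have "tf_at_inf H = mat 1 + tf_at_inf M ** tf_at_inf T"
    by (subst eqs(2)) (simp only: RH_inf_add(3)[OF I(1) MT(1)] I(3) MT(3))
  also have "tf_at_inf M ** tf_at_inf T = 0" by (simp add: Ti matrix_mul_assoc MN)
  finally have "tf_at_inf H = mat 1" by simp
  then have TN: "tf_at_inf T = tf_at_inf N" by (simp add: Ti)
  have "neg_imag T"
    unfolding neg_imag_def
  proof (intro conjI allI impI T)
    fix w :: real and x assume w: "w > 0"
    define s where "s = \<i> * complex_of_real w"
    have s: "Re s \<ge> 0" by (simp add: s_def)
    define h where "h = tf_eval H s *v x"
    define t where "t = tf_eval T s *v x"
    have t: "t = tf_eval N s *v h" by (simp add: t_def h_def Ts[OF s] matrix_vector_mul_assoc)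
    have "h = x + tf_eval M s *v t"
      unfolding h_def t_def by (subst Hs[OF s]) (simp add: matrix_vector_mult_add_rdistrib matrix_vector_mul_assoc)
    then have "x = h - tf_eval M s *v t" by simp
    then have "cip x t = qf N s h - cnj (qf M s t)"
      by (simp add: cip_diff_left cnj_cip flip: t)
    moreover have "Im (qf N s h) \<le> 0" "Im (qf M s t) \<le> 0"
      using M strictly_neg_imag_imp[OF N] w by (simp_all add: neg_imag_def s_def)
    ultimately show "Im (qf T (\<i> * complex_of_real w) x) \<le> 0" by (simp flip: s_def t_def)
  qed
  then have Tpos: "Re (qf T 0 x) \<ge> 0" for x
    using neg_imag_inf_le_zero(1)[of T x] psd[of x] by (simp add: TN)
  \<comment> \<open>\<open>H(0)\<close> inverts \<open>1 - M(0) N(0)\<close>, which maps \<open>u\<close> to \<open>(1 - \<mu>) u\<close>.\<close>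
  have "tf_eval H 0 = mat 1 + tf_eval M 0 ** tf_eval N 0 ** tf_eval H 0"
    using Hs[of 0] Ts[of 0] by (simp add: matrix_mul_assoc)
  then have "(mat 1 - tf_eval M 0 ** tf_eval N 0) ** tf_eval H 0 = mat 1"
    by (simp add: matrix_eq matrix_vector_mult_diff_rdistrib matrix_vector_mult_add_rdistrib
        diff_eq_eq flip: matrix_vector_mul_assoc)
  then have inv: "tf_eval H 0 ** (mat 1 - tf_eval M 0 ** tf_eval N 0) = mat 1"
    by (simp add: matrix_left_right_inverse)
  have "(mat 1 - tf_eval M 0 ** tf_eval N 0) *v u = complex_of_real (1 - \<mu>) *s u"
    using u(2) by (simp add: matrix_vector_mult_diff_rdistrib vector_sub_rdistrib
        flip: matrix_vector_mul_assoc)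
  then have "tf_eval H 0 *v (complex_of_real (1 - \<mu>) *s u) = u"
    using inv by (metis matrix_vector_mul_assoc matrix_vector_mul_lid)
  then have Hu: "complex_of_real (1 - \<mu>) *s (tf_eval H 0 *v u) = u"
    by (simp only: vector_scalar_commute)
  have "complex_of_real (1 - \<mu>) * qf T 0 u = qf N 0 u"
  proof -
    have "tf_eval N 0 *v u = tf_eval N 0 *v (complex_of_real (1 - \<mu>) *s (tf_eval H 0 *v u))"
      by (simp only: Hu)
    also have "\<dots> = complex_of_real (1 - \<mu>) *s (tf_eval T 0 *v u)"
      using Ts[of 0] by (simp only: vector_scalar_commute matrix_vector_mul_assoc zero_complex.sel order_refl)
    finally show ?thesis by (simp only: cip_scale_right)
  qed
  then have "Re (complex_of_real (1 - \<mu>) * qf T 0 u) = Re (qf N 0 u)" by simp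
  then have "(1 - \<mu>) * Re (qf T 0 u) = Re (qf N 0 u)" by simp
  also have "\<dots> > 0" by (rule strictly_neg_imag_pos_at_0[OF N psd u(1)])
  finally show "\<mu> < 1" using Tpos[of u] by (simp add: zero_less_mult_iff)
qed

theorem theorem5:
  fixes M N :: "('n::finite) tfm"
  assumes "M \<in> NI_class"
    and "N \<in> strict_NI_class"
    and "tf_at_inf M ** tf_at_inf N = 0"
    and "pos_semidef (tf_at_inf N)"
  shows "internally_stable M N \<longleftrightarrow> max_eigenvalue (tf_eval M 0 ** tf_eval N 0) < 1"
proof -
  have M: "neg_imag M" by (rule NI_class_imp_neg_imag[OF assms(1)])
  have N: "strictly_neg_imag N" by (rule strict_NI_class_imp[OF assms(2)])
  have psd: "Re (cip x (tf_at_inf N *v x)) \<ge> 0" for x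
    using assms(4) by (simp add: pos_semidef_def cip_def)
  have pos: "Re (qf N 0 x) > 0" if "x \<noteq> 0" for x
    by (rule strictly_neg_imag_pos_at_0[OF N psd that])
  define \<mu> where "\<mu> = max_eigenvalue (tf_eval M 0 ** tf_eval N 0)"
  obtain u where u: "u \<noteq> 0" "tf_eval M 0 *v (tf_eval N 0 *v u) = complex_of_real \<mu> *s u"
    "\<forall>x. Re (cip (tf_eval N 0 *v x) (tf_eval M 0 *v (tf_eval N 0 *v x))) \<le> \<mu> * Re (qf N 0 x)"
    unfolding \<mu>_def
    by (rule max_eigenvalue_product[OF real_form_at_0[OF M] real_form_at_0[OF strictly_neg_imag_imp[OF N]] pos])
  have "internally_stable M N" if "\<mu> < 1"
  proof (rule stable_of_dc_gain[OF M N psd assms(3)])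
    fix x :: "complex ^ 'n" assume "x \<noteq> 0"
    then have "\<mu> * Re (qf N 0 x) < 1 * Re (qf N 0 x)"
      using that pos by (intro mult_strict_right_mono)
    then show "Re (qf M 0 (tf_eval N 0 *v x)) < Re (qf N 0 x)"
      using u(3)[THEN spec, of x] by linarith
  qed
  moreover have "\<mu> < 1" if "internally_stable M N"
    by (rule dc_gain_of_stable[OF M N psd assms(3) that u(1,2)])
  ultimately show ?thesis unfolding \<mu>_def by blast
qed

end
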